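(* Let $p,p'$ be integers with $1<p$, $3p/2<p'<2p$ and $\gcd(p,p')=1$, and let integers $1\le r<p$ and $1\le s<p'$ be fixed by $|p'r-ps|=1$. Let $d$, $\mathcal I$ and $B$ be the integer and the $d\times d$ matrices attached to the continued fraction expansion of $p/(p'-p)$ as described in the context. Then for every $L\in\mathbb Z$, $$\sum_{m+Le_1\in 2\mathbb Z^d} q^{\frac14 L(L-2m_2)+\frac12 mBm}\prod_{j=1}^d\genfrac{[}{]}{0pt}{}{\frac12 L(\delta_{j,1}+\delta_{j,2})+\frac12(\mathcal I m)_j}{m_j}$$ $$=\sum_{j=-\infty}^{\infty}\Bigl\{q^{\frac12 j(p'(2p-p')j+2)}\,T_0(L,p'j)-q^{\frac12((2p-p')j+2r-s)(p'j+s)}\,T_0(L,p'j+s)\Bigr\},$$ where the left-hand sum is over all $m=(m_1,\dots,m_d)\in\mathbb Z^d$ such that $m_1+L$ and $m_2,\dots,m_d$ are even, and $m_2$ is read as $0$ if $d=1$.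
   Context: $q$ is an indeterminate (with formal fractional powers). $(q)_0=1$, $(q)_n=\prod_{j=1}^n(1-q^j)$ for $n\ge1$. $\genfrac{[}{]}{0pt}{}{n}{a}=\frac{(q)_n}{(q)_a(q)_{n-a}}$ if $0\le a\le n$, and $0$ otherwise (in particular $0$ if $n<0$). The $q$-trinomial coefficient is $$T_0(L,a)=\sum_{\substack{r=0\\ L-a-r\text{ even}}}^{L-|a|}\frac{q^{\frac12 r^2}(q)_L}{(q)_{\frac{L-a-r}{2}}(q)_{\frac{L+a-r}{2}}(q)_r},$$ which is $0$ if $L<|a|$ (empty sum). Matrices. Write the continued fraction expansion $$\frac{p}{p'-p}=\nu_0+\cfrac{1}{\nu_1+\cfrac{1}{\ddots+\cfrac{1}{\nu_n+2}}}=[\nu_0,\dots,\nu_{n-1},\nu_n+2],$$ with integers $n\ge 0$, $\nu_0,\dots,\nu_{n-1}\ge1$ and $\nu_n\ge0$. Put $t_m=\sum_{j=0}^{m-1}\nu_j$ for $1\le m\le n$ and $d=\sum_{j=0}^n\nu_j$. The $d\times d$ matrix $\mathcal I$ has entries $$\mathcal I_{i,j}=\begin{cases}\delta_{i,j+1}+\delta_{i,j-1} & \text{for } 1\le i<d,\ i\ne t_m,\\ \delta_{i,j+1}+\delta_{i,j}-\delta_{i,j-1} & \text{for } i=t_m,\ 1\le m\le n-\delta_{\nu_n,0},\\ \delta_{i,j+1}+\delta_{\nu_n,0}\,\delta_{i,j} & \text{for } i=d,\end{cases}$$ and $B$ is defined by $2B=2I-\mathcal I$ with $I$ the $d\times d$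 identity matrix. Notation: $mBm=\sum_{j,k}m_jB_{j,k}m_k$, $(\mathcal I m)_j=\sum_k\mathcal I_{j,k}m_k$, and $e_1$ is the first standard unit vector of $\mathbb Z^d$. *)

theory Defs
  imports
    "HOL-Computational_Algebra.Formal_Laurent_Series"
    "HOL-Library.Groups_Big_Fun"
begin

(* All identities live in the field of formal Laurent series over the rationals in an
   indeterminate x which plays the role of q^(1/4); all exponents of q that occur are multiples
   of 1/4.  The floor makes qpow total and is only meaningful where 4 * e is an integer
   (see qpow_of_quarter and fermionic_exponent). *)
definition qpow :: "rat \<Rightarrow> rat fls" where
  "qpow e = fls_X_intpow \<lfloor>4 * e\<rfloor>"

definition qpoch :: "nat \<Rightarrow> rat fls" where
  "qpoch n = (\<Prod>j = 1..n. 1 - qpow (of_nat j))"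

definition qbinom :: "int \<Rightarrow> int \<Rightarrow> rat fls" where
  "qbinom n a =
     (if 0 \<le> a \<and> a \<le> n then qpoch (nat n) / (qpoch (nat a) * qpoch (nat (n - a))) else 0)"

definition T0 :: "int \<Rightarrow> int \<Rightarrow> rat fls" where
  "T0 L a =
     (\<Sum>r \<in> {r. 0 \<le> r \<and> r \<le> L - \<bar>a\<bar> \<and> even (L - a - r)}.
        qpow (of_int (r\<^sup>2) / 2) * qpoch (nat L) /
          (qpoch (nat ((L - a - r) div 2)) * qpoch (nat ((L + a - r) div 2)) * qpoch (nat r)))"

fun cfrac_eval :: "nat list \<Rightarrow> rat" where
  "cfrac_eval [] = 0"
| "cfrac_eval [a] = of_nat a"
| "cfrac_eval (a # b # as) = of_nat a + 1 / cfrac_eval (b # as)"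

definition cfrac_expansion :: "rat \<Rightarrow> nat \<Rightarrow> (nat \<Rightarrow> nat) \<Rightarrow> bool" where
  "cfrac_expansion x n \<nu> \<longleftrightarrow>
     (\<forall>i<n. 1 \<le> \<nu> i) \<and> x = cfrac_eval (map \<nu> [0..<n] @ [\<nu> n + 2])"

definition tpos :: "(nat \<Rightarrow> nat) \<Rightarrow> nat \<Rightarrow> nat" where
  "tpos \<nu> m = (\<Sum>j<m. \<nu> j)"

definition cf_dim :: "nat \<Rightarrow> (nat \<Rightarrow> nat) \<Rightarrow> nat" where
  "cf_dim n \<nu> = (\<Sum>j\<le>n. \<nu> j)"

definition kron :: "nat \<Rightarrow> nat \<Rightarrow> int" where
  "kron i j = (if i = j then 1 else 0)"

(* Rows and columns are indexed by 1..cf_dim n \<nu>.  "i = j - 1" is written "i + 1 = j" to avoid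
   truncated subtraction.  The last branch is the row i = cf_dim n \<nu>; if \<nu> n = 0, then
   tpos \<nu> n = cf_dim n \<nu>, which is why the second branch stops at n - 1 in that case. *)
definition Imat :: "nat \<Rightarrow> (nat \<Rightarrow> nat) \<Rightarrow> nat \<Rightarrow> nat \<Rightarrow> int" where
  "Imat n \<nu> i j =
     (if i < cf_dim n \<nu> \<and> (\<forall>m\<in>{1..n}. i \<noteq> tpos \<nu> m)
        then kron i (j + 1) + kron (i + 1) j
      else if \<exists>m\<in>{1..n - (if \<nu> n = 0 then 1 else 0)}. i = tpos \<nu> m
        then kron i (j + 1) + kron i j - kron (i + 1) j
      else kron i (j + 1) + kron (\<nu> n) 0 * kron i j)"

definition Bmat :: "nat \<Rightarrow> (nat \<Rightarrow> nat) \<Rightarrow> nat \<Rightarrow> nat \<Rightarrow> rat" where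
  "Bmat n \<nu> i j = (2 * of_int (kron i j) - of_int (Imat n \<nu> i j)) / 2"

definition mBm :: "nat \<Rightarrow> (nat \<Rightarrow> nat) \<Rightarrow> (nat \<Rightarrow> int) \<Rightarrow> rat" where
  "mBm n \<nu> m =
     (\<Sum>j = 1..cf_dim n \<nu>. \<Sum>k = 1..cf_dim n \<nu>. of_int (m j) * Bmat n \<nu> j k * of_int (m k))"

definition Imul :: "nat \<Rightarrow> (nat \<Rightarrow> nat) \<Rightarrow> (nat \<Rightarrow> int) \<Rightarrow> nat \<Rightarrow> int" where
  "Imul n \<nu> m j = (\<Sum>k = 1..cf_dim n \<nu>. Imat n \<nu> j k * m k)"

(* An integer vector of length d is a function that vanishes outside 1..d; in particular m 2 = 0
   if d = 1. *)
definition int_vecs :: "nat \<Rightarrow> (nat \<Rightarrow> int) set" where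
  "int_vecs d = {m. \<forall>j. j \<notin> {1..d} \<longrightarrow> m j = 0}"

definition summation_vecs :: "nat \<Rightarrow> int \<Rightarrow> (nat \<Rightarrow> int) set" where
  "summation_vecs d L = {m \<in> int_vecs d. \<forall>j\<in>{1..d}. even (m j + L * kron j 1)}"

(* Under the summation condition the division by 2 is exact, see even_top. *)
definition fermionic_term :: "nat \<Rightarrow> (nat \<Rightarrow> nat) \<Rightarrow> int \<Rightarrow> (nat \<Rightarrow> int) \<Rightarrow> rat fls" where
  "fermionic_term n \<nu> L m =
     qpow (of_int (L * (L - 2 * m 2)) / 4 + mBm n \<nu> m / 2) *
     (\<Prod>j = 1..cf_dim n \<nu>. qbinom ((L * (kron j 1 + kron j 2) + Imul n \<nu> m j) div 2) (m j))"

definition bosonic_term :: "int \<Rightarrow> int \<Rightarrow> int \<Rightarrow> int \<Rightarrow> int \<Rightarrow> int \<Rightarrow> rat fls" where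
  "bosonic_term p p' r s L j =
     qpow (of_int (j * (p' * (2 * p - p') * j + 2)) / 2) * T0 L (p' * j)
     - qpow (of_int (((2 * p - p') * j + 2 * r - s) * (p' * j + s)) / 2) * T0 L (p' * j + s)"


(* The remaining facts show that the conventions above are harmless: exponents are multiples of
   1/4, upper entries of the q-binomials are integers, and both sums (taken with Sum_any, which
   is 0 by convention on infinite support) have finite support. *)

lemma qpow_of_quarter: "qpow (of_int k / 4) = fls_X_intpow k"
  by (simp add: qpow_def)

lemma fermionic_exponent:
  "\<exists>k. of_int (L * (L - 2 * m 2)) / 4 + mBm n \<nu> m / 2 = (of_int k / 4 :: rat)"
proof
  let ?D = "{1..cf_dim n \<nu>}"
  let ?S = "\<Sum>j\<in>?D. \<Sum>k\<in>?D. m j * (2 * kron j k - Imat n \<nu> j k) * m k"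
  have "mBm n \<nu> m = of_int ?S / 2"
    unfolding mBm_def Bmat_def by (simp add: sum_divide_distrib)
  then show "of_int (L * (L - 2 * m 2)) / 4 + mBm n \<nu> m / 2
      = (of_int (L * (L - 2 * m 2) + ?S) / 4 :: rat)"
    by (simp add: add_divide_distrib)
qed

lemma cfrac_eval_gt_1:
  "xs \<noteq> [] \<Longrightarrow> \<forall>x\<in>set xs. 1 \<le> x \<Longrightarrow> 2 \<le> last xs \<Longrightarrow> 1 < cfrac_eval xs"
proof (induction xs rule: cfrac_eval.induct)
  case (3 a b as)
  then have "1 < cfrac_eval (b # as)" by simp
  then have "0 < 1 / cfrac_eval (b # as)" by simp
  moreover have "1 \<le> (of_nat a :: rat)" using 3 by simp
  ultimately show ?case unfolding cfrac_eval.simps by linarith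
qed auto

lemma cfrac_expansion_start:
  assumes "cfrac_expansion x n \<nu>" and "x < 2"
  shows "1 \<le> n" and "\<nu> 0 = 1"
proof -
  have pos: "\<forall>i<n. 1 \<le> \<nu> i" and x: "x = cfrac_eval (map \<nu> [0..<n] @ [\<nu> n + 2])"
    using assms(1) by (auto simp: cfrac_expansion_def)
  show n: "1 \<le> n"
    using x assms(2) by (cases n) auto
  let ?ys = "map \<nu> [1..<n] @ [\<nu> n + 2]"
  have "map \<nu> [0..<n] = \<nu> 0 # map \<nu> [1..<n]"
    using n by (simp add: upt_conv_Cons)
  then have x': "x = cfrac_eval (\<nu> 0 # ?ys)" using x by simp
  have "1 < cfrac_eval ?ys"
    using pos by (intro cfrac_eval_gt_1) auto
  moreover obtain b bs where "?ys = b # bs" by (cases ?ys) auto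
  ultimately have "of_nat (\<nu> 0) < x" using x' by simp
  then have "of_nat (\<nu> 0) < (of_nat 2 :: rat)" using assms(2) by simp
  then have "\<nu> 0 < 2" by (simp only: of_nat_less_iff)
  moreover have "1 \<le> \<nu> 0" using pos n by auto
  ultimately show "\<nu> 0 = 1" by simp
qed

lemma Imul_eq:
  assumes "m \<in> int_vecs (cf_dim n \<nu>)" and "1 \<le> j"
  shows "Imul n \<nu> m j =
     (if j < cf_dim n \<nu> \<and> (\<forall>k\<in>{1..n}. j \<noteq> tpos \<nu> k) then m (j - 1) + m (j + 1)
      else if \<exists>k\<in>{1..n - (if \<nu> n = 0 then 1 else 0)}. j = tpos \<nu> k
        then m (j - 1) + m j - m (j + 1)
      else m (j - 1) + kron (\<nu> n) 0 * m j)"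
proof -
  let ?D = "{1..cf_dim n \<nu>}"
  have z: "m i = 0" if "i \<notin> ?D" for i
    using assms(1) that by (auto simp: int_vecs_def)
  have s: "(\<Sum>k\<in>?D. kron i k * m k) = m i" for i
  proof -
    have "(\<Sum>k\<in>?D. kron i k * m k) = (\<Sum>k\<in>?D. if i = k then m k else 0)"
      by (intro sum.cong) (auto simp: kron_def)
    also have "\<dots> = m i" using z[of i] by (simp only: sum.delta' finite_atLeastAtMost) auto
    finally show ?thesis .
  qed
  have sL: "(\<Sum>k\<in>?D. kron j (k + 1) * m k) = m (j - 1)"
  proof -
    have "kron j (k + 1) = kron (j - 1) k" for k
      using assms(2) by (auto simp: kron_def)
    then show ?thesis using s by simp
  qed
  have sC: "(\<Sum>k\<in>?D. c * kron j k * m k) = c * m j" for c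
    using s[of j] by (simp add: sum_distrib_left[symmetric] mult.assoc)
  have s1: "(\<Sum>k\<in>?D. (kron j (k + 1) + kron (j + 1) k) * m k) = m (j - 1) + m (j + 1)"
    by (simp only: ring_distribs sum.distrib sL s)
  have s2: "(\<Sum>k\<in>?D. (kron j (k + 1) + kron j k - kron (j + 1) k) * m k)
      = m (j - 1) + m j - m (j + 1)"
    by (simp only: ring_distribs sum.distrib sum_subtractf sL s)
  have s3: "(\<Sum>k\<in>?D. (kron j (k + 1) + c * kron j k) * m k) = m (j - 1) + c * m j" for c
    by (simp only: ring_distribs sum.distrib sL sC)
  have split3: "(\<Sum>k\<in>?D. (if P then f k else if Q then g k else h k) * m k)
      = (if P then \<Sum>k\<in>?D. f k * m k else if Q then \<Sum>k\<in>?D. g k * m k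
         else \<Sum>k\<in>?D. h k * m k)" for P Q :: bool and f g h :: "nat \<Rightarrow> int"
    by (cases P; cases Q) simp_all
  show ?thesis
    unfolding Imul_def Imat_def split3 s1 s2 s3 ..
qed

lemma even_top:
  assumes "m \<in> summation_vecs (cf_dim n \<nu>) L" and "1 \<le> n" and "\<nu> 0 = 1"
    and "j \<in> {1..cf_dim n \<nu>}"
  shows "even (L * (kron j 1 + kron j 2) + Imul n \<nu> m j)"
proof -
  have m: "m \<in> int_vecs (cf_dim n \<nu>)" using assms(1) by (auto simp: summation_vecs_def)
  have ev: "even (m i)" if "i \<noteq> 1" for i
    using assms(1) that unfolding summation_vecs_def int_vecs_def kron_def
    by (cases "i \<in> {1..cf_dim n \<nu>}") force+
  have "1 \<in> {1..cf_dim n \<nu>}" using assms(4) by auto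
  then have "even (m 1 + L * kron 1 1)" using assms(1) unfolding summation_vecs_def by blast
  then have o: "even (m 1) \<longleftrightarrow> even L" by (simp add: kron_def)
  have t1: "1 = tpos \<nu> 1" using assms(3) by (simp add: tpos_def)
  have z: "m 0 = 0" using m by (simp add: int_vecs_def)
  consider "j = 1" | "j = 2" | "3 \<le> j" using assms(4) by force
  then show ?thesis
  proof cases
    case 1
    have b1: "\<not> (\<forall>k\<in>{1..n}. 1 \<noteq> tpos \<nu> k)" using t1 assms(2) by force
    have "kron (\<nu> n) 0 = 1" if "\<not> (\<exists>k\<in>{1..n - (if \<nu> n = 0 then 1 else 0)}. 1 = tpos \<nu> k)"
    proof (rule ccontr)
      assume "kron (\<nu> n) 0 \<noteq> 1"
      then have "\<nu> n \<noteq> 0" by (auto simp: kron_def split: if_splits)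
      then show False using that t1 assms(2) by force
    qed
    then have "Imul n \<nu> m 1 = m 1 - m 2 \<or> Imul n \<nu> m 1 = m 1"
      using Imul_eq[OF m, of 1] b1 z by (auto split: if_splits simp: numeral_2_eq_2)
    then show ?thesis using 1 o ev[of 2] by (auto simp: kron_def)
  next
    case 2
    then show ?thesis using Imul_eq[OF m, of 2] ev[of 2] ev[of 3] o
      by (auto split: if_splits simp: kron_def)
  next
    case 3
    then show ?thesis using Imul_eq[OF m, of j] ev[of j] ev[of "j + 1"] ev[of "j - 1"]
      by (auto split: if_splits simp: kron_def)
  qed
qed

lemma finite_fermionic:
  assumes "1 \<le> n" and "\<nu> 0 = 1"
  shows "finite {m. (if m \<in> summation_vecs (cf_dim n \<nu>) L then fermionic_term n \<nu> L m else 0) \<noteq> 0}"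
proof (rule finite_subset)
  let ?d = "cf_dim n \<nu>"
  show "finite {m. \<forall>i. (i \<in> {1..?d} \<longrightarrow> m i \<in> {0..\<bar>L\<bar>}) \<and> (i \<notin> {1..?d} \<longrightarrow> m i = 0)}"
    by (rule finite_set_of_finite_funs) auto
  show "{m. (if m \<in> summation_vecs ?d L then fermionic_term n \<nu> L m else 0) \<noteq> 0} \<subseteq> \<dots>"
  proof
    fix m
    assume "m \<in> {m. (if m \<in> summation_vecs ?d L then fermionic_term n \<nu> L m else 0) \<noteq> 0}"
    then have ms: "m \<in> summation_vecs ?d L" and nz: "fermionic_term n \<nu> L m \<noteq> 0"
      by (auto split: if_splits)
    have mi: "m \<in> int_vecs ?d" using ms by (auto simp: summation_vecs_def)
    have z: "m i = 0" if "i \<notin> {1..?d}" for i using mi that by (auto simp: int_vecs_def)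
    have *: "qbinom ((L * (kron j 1 + kron j 2) + Imul n \<nu> m j) div 2) (m j) \<noteq> 0"
      if "j \<in> {1..?d}" for j
      using nz that unfolding fermionic_term_def by auto
    then have b: "0 \<le> m j" "m j \<le> (L * (kron j 1 + kron j 2) + Imul n \<nu> m j) div 2"
      if "j \<in> {1..?d}" for j
      using *[OF that] by (auto simp: qbinom_def split: if_splits)
    have nn: "0 \<le> m i" for i using b(1)[of i] z[of i] by (cases "i \<in> {1..?d}") auto
    have b2: "2 * m j \<le> L * (kron j 1 + kron j 2) + Imul n \<nu> m j" if "j \<in> {1..?d}" for j
      using b(2)[OF that] by linarith
    have dec: "m (i + 1) \<le> m i" if "2 \<le> i" for i
    proof (cases "i \<le> ?d")
      case True
      then show ?thesis using \<open>2 \<le> i\<close>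
      proof (induction rule: inc_induct)
        case base
        then show ?case using z[of "?d + 1"] nn by auto
      next
        case (step i)
        have "2 * m (i + 1) \<le> Imul n \<nu> m (i + 1)"
          using b2[of "i + 1"] step by (auto simp: kron_def)
        moreover have "m (i + 2) \<le> m (i + 1)" using step by auto
        ultimately show ?case
          using Imul_eq[OF mi, of "i + 1"] nn[of "i + 2"] nn[of i] nn[of "i + 1"]
          by (auto split: if_splits simp: kron_def)
      qed
    next
      case False
      then show ?thesis using z[of "i + 1"] nn by auto
    qed
    have t1: "1 = tpos \<nu> 1" using assms(2) by (simp add: tpos_def)
    have b1: "\<not> (\<forall>k\<in>{1..n}. 1 \<noteq> tpos \<nu> k)" using t1 assms(1) by force
    have d1: "1 \<le> ?d"
      using assms member_le_sum[of 0 "{..n}" \<nu>] by (simp add: cf_dim_def)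
    have d1': "?d = 1" if "\<not> (\<exists>k\<in>{1..n - (if \<nu> n = 0 then 1 else 0)}. 1 = tpos \<nu> k)"
    proof -
      have "\<nu> n = 0 \<and> n = 1"
        using that t1 assms(1) by (cases "\<nu> n = 0"; cases "n = 1") force+
      then have "\<nu> n = 0" "{..n} = {0, 1}" "\<nu> 1 = 0" by auto
      then show ?thesis using assms(2) by (simp add: cf_dim_def)
    qed
    have m12: "m 1 + m 2 \<le> L"
    proof -
      have "2 * m 1 \<le> L + Imul n \<nu> m 1" using b2[of 1] d1 by (simp add: kron_def)
      then show ?thesis
        using Imul_eq[OF mi, of 1] b1 d1' z[of 0] z[of 2]
        by (auto split: if_splits simp: kron_def numeral_2_eq_2)
    qed
    have "m i \<le> \<bar>L\<bar>" for i
    proof (cases "2 \<le> i")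
      case True
      then have "m i \<le> m 2"
      proof (induction rule: dec_induct)
        case (step k)
        then show ?case using dec[of k] by simp
      qed simp
      then show ?thesis using m12 nn[of 1] by linarith
    next
      case False
      then have "i = 0 \<or> i = 1" by auto
      then show ?thesis using m12 nn[of 2] z[of 0] by auto
    qed
    then show "m \<in> {m. \<forall>i. (i \<in> {1..?d} \<longrightarrow> m i \<in> {0..\<bar>L\<bar>}) \<and> (i \<notin> {1..?d} \<longrightarrow> m i = 0)}"
      using nn z by auto
  qed
qed

lemma T0_eq_0: "L < \<bar>a\<bar> \<Longrightarrow> T0 L a = 0"
  unfolding T0_def by (intro sum.neutral) auto

lemma finite_bosonic:
  assumes "1 \<le> p'"
  shows "finite {j. bosonic_term p p' r s L j \<noteq> 0}"
proof (rule finite_subset)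
  show "finite {-(\<bar>L\<bar> + \<bar>s\<bar>)..\<bar>L\<bar> + \<bar>s\<bar>}" by simp
  show "{j. bosonic_term p p' r s L j \<noteq> 0} \<subseteq> \<dots>"
  proof
    fix j
    assume "j \<in> {j. bosonic_term p p' r s L j \<noteq> 0}"
    then have "T0 L (p' * j) \<noteq> 0 \<or> T0 L (p' * j + s) \<noteq> 0"
      by (auto simp: bosonic_term_def)
    then have "\<bar>p' * j\<bar> \<le> L \<or> \<bar>p' * j + s\<bar> \<le> L"
      using T0_eq_0 not_le by blast
    then have "\<bar>p' * j\<bar> \<le> \<bar>L\<bar> + \<bar>s\<bar>" by linarith
    moreover have "\<bar>j\<bar> \<le> \<bar>p' * j\<bar>"
      using assms mult_right_mono[of 1 p' "\<bar>j\<bar>"] by (simp add: abs_mult)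
    ultimately show "j \<in> {-(\<bar>L\<bar> + \<bar>s\<bar>)..\<bar>L\<bar> + \<bar>s\<bar>}" by auto
  qed
qed

end

theory Submission
  imports Defs
begin

text \<open>
  Write \<open>B(L, M, a, b)\<close> for the product \<open>[L+M+a-b; L+a] [L+M-a+b; L-a]\<close> of two \<open>q\<close>-binomials.
  The \<open>q\<close>-Saalschuetz sum gives the Burge transform
  \<open>\<Sum>i. q^(i^2) [2L+M-i; 2L] B(L-i, i, a, b) = q^(b^2) B(L, M, a+b, b)\<close> for \<open>a b \<ge> 0\<close>, and
  \<open>B(L, M, a, b) = B(M, L, b, a)\<close>. Together they perform the Euclidean algorithm on the pair
  \<open>(K, P)\<close> of parameters of the bosonic sum
  \<open>\<Sum>j. q^(j (K P j + 1)) B(L, M, K j, P j) - q^((K j + u) (P j + v)) B(L, M, K j + u, P j + v)\<close>,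
  which for \<open>(K, P) = (1, 1)\<close> telescopes to \<open>\<delta>(L, 0) \<delta>(M, 0)\<close>. Each step contributes one row of the
  fermionic form, a row \<open>i = t_m\<close> being a step that swaps the arguments. One more summation,
  \<open>\<Sum>l i. q^((i^2 + k^2)/2) [i; k] B(l, i, a, b) = q^(b^2/2) T_0(L, 2a+b)\<close> with \<open>k = L-i-2l\<close>,
  turns the pair \<open>(K, P) = (p'-p, 2p-p')\<close> into the bosonic side and adds the first row.
\<close>

text \<open>The origin of \<open>K = p' - p\<close> and \<open>P = 2 p - p'\<close>: with
  \<open>u = s - r\<close> and \<open>v = 2 r - s\<close> one has \<open>p' = 2 K + P\<close>,
  \<open>s = 2 u + v\<close>, \<open>p = K + P\<close>, \<open>r = u + v\<close> and
  \<open>K v - P u = p' r - p s\<close>. So the last summation, which sends \<open>(a, b)\<close> to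
  \<open>2 a + b\<close>, produces exactly \<open>p' j\<close> and \<open>p' j + s\<close>, and its
  factor \<open>q^(b^2/2)\<close> completes \<open>K P j^2\<close> to \<open>p' P j^2 / 2\<close>.
  The bound \<open>p' < 2 p\<close> gives \<open>P \<ge> 1\<close>; \<open>3 p < 2 p'\<close> gives
  \<open>p / (p' - p) < 2\<close> and hence \<open>\<nu> 0 = 1\<close>, so row 1 is always the row
  \<open>t_1\<close> which that summation accounts for, and the other rows follow the expansion of
  \<open>K / P\<close>. The obstacle is a sign condition: the Burge transform is false in general
  when \<open>a\<close> and \<open>b\<close> have opposite signs. The pairs
  \<open>(K j, P j)\<close> and \<open>(K j + u, P j + v)\<close> must lie in the closed first or
  third quadrant for every \<open>j\<close> and at every step. This is the reason for the bounds
  \<open>0 \<le> u \<le> K\<close> and \<open>0 \<le> v \<le> P\<close>; the determinant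
  \<open>|K v - P u| = 1\<close> is what preserves them when the Euclidean steps are traced
  back.\<close>

text \<open>\<open>qq k\<close> is \<open>q^(k/4)\<close>.\<close>

definition qq :: "int \<Rightarrow> rat fls" where
  "qq k = fls_X_intpow k"

lemma qq_0 [simp]: "qq 0 = 1"
  by (simp add: qq_def)

lemma qq_add: "qq (a + b) = qq a * qq b"
  by (simp add: qq_def fls_X_intpow_times_fls_X_intpow)

lemma qq_eq_1_iff: "qq a = 1 \<longleftrightarrow> a = 0"
proof
  assume "qq a = 1"
  then have "fls_subdegree (qq a) = fls_subdegree 1" by simp
  then show "a = 0" by (simp add: qq_def)
qed simp

lemma qpow_quarter: "e = of_int k / 4 \<Longrightarrow> qpow e = qq k"
proof -
  assume "e = of_int k / 4"
  then show ?thesis using qpow_of_quarter[of k] by (simp only: qq_def)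
qed

section \<open>Gaussian binomials: the \<open>q\<close>-Pascal, \<open>q\<close>-Vandermonde and
  \<open>q\<close>-Saalschuetz identities\<close>

lemma qpoch_0 [simp]: "qpoch 0 = 1"
  by (simp add: qpoch_def)

lemma qpoch_Suc: "qpoch (Suc n) = qpoch n * (1 - qq (4 * (1 + int n)))"
proof -
  have "qpow (of_nat (Suc n)) = qq (4 * (1 + int n))"
    by (rule qpow_quarter) simp
  then show ?thesis by (simp add: qpoch_def)
qed

lemma qpoch_nz [simp]: "qpoch n \<noteq> 0"
proof (induction n)
  case (Suc n)
  have "1 - qq (4 * (1 + int n)) \<noteq> 0"
    using qq_eq_1_iff[of "4 * (1 + int n)"] by auto
  then show ?case using Suc by (simp add: qpoch_Suc)
qed simp

text \<open>Inductions run on this natural-number form; \<open>qbinom\<close> stays in use where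
  entries may be negative.\<close>

definition qbin :: "nat \<Rightarrow> nat \<Rightarrow> rat fls" where
  "qbin n k = qbinom (int n) (int k)"

lemma qbin_eq: "qbin n k = (if k \<le> n then qpoch n / (qpoch k * qpoch (n - k)) else 0)"
  by (auto simp: qbin_def qbinom_def nat_diff_distrib simp flip: of_nat_diff)

lemma qbin_gt [simp]: "n < k \<Longrightarrow> qbin n k = 0"
  by (simp add: qbin_eq)

lemma qbin_0 [simp]: "qbin n 0 = 1" and qbin_self [simp]: "qbin n n = 1"
  by (simp_all add: qbin_eq)

lemma qbin_sym: "k \<le> n \<Longrightarrow> qbin n (n - k) = qbin n k"
  by (simp add: qbin_eq)

text \<open>The \<open>q\<close>-Pascal rule with \<open>x = q^(k+1)\<close> and
  \<open>y = q^(d+1)\<close> freed from their meaning; all of it rests on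
  \<open>1 - x y = (1 - x) + x (1 - y)\<close>.\<close>

lemma q_Pascal_field:
  fixes x y k d n :: "'a::field"
  assumes "x \<noteq> 1" "y \<noteq> 1" "k \<noteq> 0" "d \<noteq> 0"
  shows "n * (1 - x * y) / (k * (1 - x) * (d * (1 - y)))
    = n / (k * (d * (1 - y))) + x * (n / (k * (1 - x) * d))"
proof -
  have "1 - x * y = (1 - x) + x * (1 - y)" by (simp add: algebra_simps)
  moreover have "1 - x \<noteq> 0" "1 - y \<noteq> 0" using assms by auto
  moreover have "n * (a + x * b) / (k * a * (d * b)) = n / (k * (d * b)) + x * (n / (k * a * d))"
    if "a \<noteq> 0" "b \<noteq> 0" for a b :: 'a
    using assms(3,4) that by (simp add: divide_simps) (simp add: algebra_simps)
  ultimately show ?thesis by metis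
qed

lemma qbin_Suc: "qbin (Suc n) (Suc k) = qbin n k + qq (4 * (1 + int k)) * qbin n (Suc k)"
proof (cases "k < n")
  case True
  then obtain d where d: "n = Suc (k + d)" using less_imp_Suc_add by auto
  have *: "qq (4 * (1 + int n)) = qq (4 * (1 + int k)) * qq (4 * (1 + int d))"
    by (simp add: d algebra_simps flip: qq_add)
  have "qq (4 * (1 + int k)) \<noteq> 1" "qq (4 * (1 + int d)) \<noteq> 1"
    by (simp_all add: qq_eq_1_iff)
  moreover have "qbin (Suc n) (Suc k) = qpoch n * (1 - qq (4 * (1 + int n))) /
      (qpoch k * (1 - qq (4 * (1 + int k))) * (qpoch d * (1 - qq (4 * (1 + int d)))))"
    by (simp add: qbin_eq d qpoch_Suc)
  moreover have "qbin n k = qpoch n / (qpoch k * (qpoch d * (1 - qq (4 * (1 + int d)))))"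
    by (simp add: qbin_eq d qpoch_Suc Suc_diff_le)
  moreover have "qbin n (Suc k) = qpoch n / (qpoch k * (1 - qq (4 * (1 + int k))) * qpoch d)"
    by (simp add: qbin_eq d qpoch_Suc)
  ultimately show ?thesis
    unfolding * by (simp add: q_Pascal_field)
next
  case False
  then show ?thesis by (cases "k = n") auto
qed

lemma qbin_Suc': "qbin (Suc n) (Suc k) = qbin n (Suc k) + qq (4 * (int n - int k)) * qbin n k"
proof (cases "k < n")
  case True
  then have "qbin (Suc n) (Suc k) = qbin (Suc n) (Suc (n - Suc k))"
    using qbin_sym[of "Suc k" "Suc n"] by (simp add: Suc_diff_Suc)
  also have "\<dots> = qbin n (n - Suc k) + qq (4 * (int n - int k)) * qbin n (n - k)"
    using True by (subst qbin_Suc) (simp add: Suc_diff_Suc of_nat_diff)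
  finally show ?thesis using True by (simp add: qbin_sym)
next
  case False
  then show ?thesis by (cases "k = n") auto
qed

lemma qbin_Vandermonde:
  "qbin (m + n) k = (\<Sum>i\<le>k. qq (4 * (int i * (int m - int k + int i))) * qbin m (k - i) * qbin n i)"
proof (induction n arbitrary: k)
  case 0
  have "(\<Sum>i\<le>k. qq (4 * (int i * (int m - int k + int i))) * qbin m (k - i) * qbin 0 i)
      = (\<Sum>i\<le>k. if i = 0 then qbin m k else 0)"
    by (intro sum.cong) auto
  then show ?case by simp
next
  case (Suc n)
  show ?case
  proof (cases k)
    case (Suc l)
    let ?t = "\<lambda>k i. qq (4 * (int i * (int m - int k + int i))) * qbin m (k - i) * qbin n i"
    have e: "qq (4 * (int (Suc i) * (int m - int (Suc l) + int (Suc i)))) * qq (4 * (int n - int i))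
        = qq (4 * (int (m + n) - int l)) * qq (4 * (int i * (int m - int l + int i)))" for i
      by (simp add: algebra_simps flip: qq_add)
    have "(\<Sum>i\<le>k. qq (4 * (int i * (int m - int k + int i))) * qbin m (k - i) * qbin (Suc n) i)
        = qbin m k + (\<Sum>i\<le>l. qq (4 * (int (Suc i) * (int m - int k + int (Suc i)))) * qbin m (l - i)
            * qbin (Suc n) (Suc i))"
      by (simp only: Suc sum.atMost_Suc_shift) simp
    also have "(\<Sum>i\<le>l. qq (4 * (int (Suc i) * (int m - int k + int (Suc i)))) * qbin m (l - i)
            * qbin (Suc n) (Suc i)) = (\<Sum>i\<le>l. ?t k (Suc i) + qq (4 * (int (m + n) - int l)) * ?t l i)"
    proof (rule sum.cong[OF refl])
      fix i
      \<comment> \<open>The powers of \<open>q\<close> become variables tied by a single exponent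
        identity, so that \<open>algebra\<close> faces a polynomial identity only. The same device
        recurs below.\<close>
      have alg: "x1 * a * (b + x2 * c) = x1 * a * b + x3 * (x4 * a * c)" if "x1 * x2 = x3 * x4"
        for x1 x2 x3 x4 a b c :: "rat fls"
        using that by algebra
      show "qq (4 * (int (Suc i) * (int m - int k + int (Suc i)))) * qbin m (l - i) * qbin (Suc n) (Suc i)
          = ?t k (Suc i) + qq (4 * (int (m + n) - int l)) * ?t l i"
        unfolding qbin_Suc' Suc diff_Suc_Suc by (rule alg[OF e])
    qed
    also have "\<dots> = (\<Sum>i\<le>l. ?t k (Suc i)) + (\<Sum>i\<le>l. qq (4 * (int (m + n) - int l)) * ?t l i)"
      by (rule sum.distrib)
    also have "qbin m k + \<dots> = (qbin m k + (\<Sum>i\<le>l. ?t k (Suc i))) + (\<Sum>i\<le>l. qq (4 * (int (m + n) - int l)) * ?t l i)"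
      by (rule add.assoc[symmetric])
    also have "qbin m k + (\<Sum>i\<le>l. ?t k (Suc i)) = (\<Sum>i\<le>k. ?t k i)"
      by (simp only: Suc sum.atMost_Suc_shift) simp
    also have "\<dots> = qbin (m + n) k" by (rule Suc.IH[symmetric])
    also have "(\<Sum>i\<le>l. qq (4 * (int (m + n) - int l)) * ?t l i) = qq (4 * (int (m + n) - int l)) * qbin (m + n) l"
      by (simp only: Suc.IH[of l] sum_distrib_left)
    finally show ?thesis by (simp add: Suc qbin_Suc')
  qed simp
qed

lemma qbin_Vandermonde':
  "qbin (m + n) k = (\<Sum>i\<le>k. qq (4 * ((int m - int i) * (int k - int i))) * qbin m i * qbin n (k - i))"
proof -
  have "qbin (m + n) k = (\<Sum>i\<le>k. qq (4 * (int (k - i) * (int m - int k + int (k - i)))) * qbin m (k - (k - i)) * qbin n (k - i))"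
    unfolding qbin_Vandermonde[of m n]
    by (rule sum.reindex_bij_witness[of _ "\<lambda>i. k - i" "\<lambda>i. k - i"]) auto
  also have "\<dots> = (\<Sum>i\<le>k. qq (4 * ((int m - int i) * (int k - int i))) * qbin m i * qbin n (k - i))"
    by (intro sum.cong refl) (simp add: of_nat_diff mult.commute)
  finally show ?thesis .
qed

text \<open>Trinomial revision: both sides are the same multinomial coefficient, and both are 0 when
  \<open>a + i > n\<close>.\<close>

lemma qbin_trinomial: "qbin n a * qbin (n - a) i = qbin n (a + i) * qbin (a + i) i"
proof (cases "a + i \<le> n")
  case True
  then have "n - (a + i) = n - a - i" by simp
  with True show ?thesis by (simp add: qbin_eq)
next
  case False
  then show ?thesis by (cases "a \<le> n") auto
qed

lemma sum_triangle:
  fixes f :: "nat \<Rightarrow> nat \<Rightarrow> 'a::comm_monoid_add"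
  shows "(\<Sum>j\<le>s. \<Sum>i\<le>s - j. f j i) = (\<Sum>h\<le>s. \<Sum>j\<le>h. f j (h - j))"
  unfolding sum.Sigma[OF finite_atMost ballI[OF finite_atMost]]
  by (rule sum.reindex_bij_witness[of _ "\<lambda>(h, j). (j, h - j)" "\<lambda>(j, i). (j + i, j)"]) auto

text \<open>Expanding the first factor by Vandermonde leaves two further Vandermonde sums.\<close>

lemma qbin_Saalschuetz:
  "(\<Sum>j\<le>s. qq (4 * (int j * (int j + int c))) * qbin (m + n + s - j) (m + n) * qbin m j * qbin n (j + c))
    = qbin (m + s + c) s * qbin (n + s) (s + c)"
proof -
  let ?g = "\<lambda>j i. qq (4 * (int j * (int j + int c))) * qq (4 * ((int n - int c - int (j + i)) * (int s - int (j + i))))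
      * qbin (m + s + c) (s - (j + i)) * qbin m j * (qbin n (c + (j + i)) * qbin (c + (j + i)) i)"
  have trm: "qq (4 * (int j * (int j + int c))) * qbin (m + n + s - j) (m + n) * qbin m j * qbin n (j + c)
      = (\<Sum>i\<le>s - j. ?g j i)" if "j \<le> s" for j
  proof (cases "c + j \<le> n")
    case True
    \<comment> \<open>After complementing the lower entry, the upper entry is split so that one
      part, \<open>m + s + c\<close>, does not depend on \<open>j\<close>.\<close>
    have "qbin (m + n + s - j) (m + n) = qbin ((n - (c + j)) + (m + s + c)) (s - j)"
    proof -
      have "n - (c + j) + (m + s + c) = m + n + s - j" "m + n + s - j - (m + n) = s - j"
        using True that by auto
      then show ?thesis using qbin_sym[of "m + n" "m + n + s - j"] that by simp
    qed
    also have "\<dots> = (\<Sum>i\<le>s - j. qq (4 * ((int (n - (c + j)) - int i) * (int (s - j) - int i))) * qbin (n - (c + j)) i * qbin (m + s + c) (s - j - i))"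
      by (rule qbin_Vandermonde')
    finally have "qq (4 * (int j * (int j + int c))) * qbin (m + n + s - j) (m + n) * qbin m j * qbin n (j + c)
        = (\<Sum>i\<le>s - j. qq (4 * (int j * (int j + int c))) * (qq (4 * ((int (n - (c + j)) - int i) * (int (s - j) - int i))) * qbin (n - (c + j)) i * qbin (m + s + c) (s - j - i)) * qbin m j * qbin n (j + c))"
      by (simp only: sum_distrib_left sum_distrib_right)
    also have "\<dots> = (\<Sum>i\<le>s - j. ?g j i)"
    proof (rule sum.cong[OF refl])
      fix i assume "i \<in> {..s - j}"
      have 1: "4 * ((int (n - (c + j)) - int i) * (int (s - j) - int i)) = 4 * ((int n - int c - int (j + i)) * (int s - int (j + i)))"
        using True that by (simp add: of_nat_diff algebra_simps)
      have 2: "qbin n (c + (j + i)) * qbin (c + (j + i)) i = qbin n (c + j) * qbin (n - (c + j)) i"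
        using qbin_trinomial[of n "c + j" i] by (simp add: add.assoc)
      show "qq (4 * (int j * (int j + int c))) * (qq (4 * ((int (n - (c + j)) - int i) * (int (s - j) - int i))) * qbin (n - (c + j)) i * qbin (m + s + c) (s - j - i)) * qbin m j * qbin n (j + c) = ?g j i"
        unfolding 1 2 by (simp add: mult_ac add_ac)
    qed
    finally show ?thesis .
  qed auto
  have "(\<Sum>j\<le>s. qq (4 * (int j * (int j + int c))) * qbin (m + n + s - j) (m + n) * qbin m j * qbin n (j + c))
      = (\<Sum>j\<le>s. \<Sum>i\<le>s - j. ?g j i)"
    using trm by (intro sum.cong) auto
  also have "\<dots> = (\<Sum>h\<le>s. \<Sum>j\<le>h. ?g j (h - j))"
    by (rule sum_triangle)
  also have "\<dots> = (\<Sum>h\<le>s. qbin (m + s + c) s * (qq (4 * ((int n - int (c + h)) * (int s - int h))) * qbin n (c + h) * qbin s (s - h)))"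
  proof (rule sum.cong[OF refl])
    fix h assume "h \<in> {..s}"
    then have h: "h \<le> s" by simp
    \<comment> \<open>For fixed \<open>h = j + i\<close> the sum over \<open>j\<close> is a
      Vandermonde sum with value \<open>[c+h+m; h]\<close>.\<close>
    have "(\<Sum>j\<le>h. ?g j (h - j)) = (\<Sum>j\<le>h. qq (4 * ((int n - int (c + h)) * (int s - int h))) * qbin n (c + h) * qbin (m + s + c) (s - h)
        * (qq (4 * (int j * (int (c + h) - int h + int j))) * qbin (c + h) (h - j) * qbin m j))"
      by (intro sum.cong refl) (simp add: algebra_simps)
    also have "\<dots> = qq (4 * ((int n - int (c + h)) * (int s - int h))) * qbin n (c + h) * qbin (m + s + c) (s - h) * qbin (c + h + m) h"
      by (simp only: qbin_Vandermonde sum_distrib_left)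
    finally have 1: "(\<Sum>j\<le>h. ?g j (h - j)) = qq (4 * ((int n - int (c + h)) * (int s - int h))) * qbin n (c + h) * qbin (m + s + c) (s - h) * qbin (c + h + m) h" .
    have alg: "x * a * b * d = y * (x * a * e)" if "b * d = y * e" for x a b d y e :: "rat fls"
      using that by algebra
    \<comment> \<open>Trinomial revision extracts \<open>[m+s+c; s]\<close>, which is free of
      \<open>h\<close>; what is left is the second Vandermonde sum.\<close>
    have "qbin (m + s + c) (s - h) * qbin (c + h + m) h = qbin (m + s + c) s * qbin s (s - h)"
      using qbin_trinomial[of "m + s + c" "s - h" h] h by (simp add: qbin_sym add_ac)
    then have "qq (4 * ((int n - int (c + h)) * (int s - int h))) * qbin n (c + h) * qbin (m + s + c) (s - h) * qbin (c + h + m) h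
       = qbin (m + s + c) s * (qq (4 * ((int n - int (c + h)) * (int s - int h))) * qbin n (c + h) * qbin s (s - h))"
      by (rule alg)
    with 1 show "(\<Sum>j\<le>h. ?g j (h - j)) = qbin (m + s + c) s * (qq (4 * ((int n - int (c + h)) * (int s - int h))) * qbin n (c + h) * qbin s (s - h))" by (simp only:)
  qed
  also have "\<dots> = qbin (m + s + c) s * (\<Sum>h\<le>s. qq (4 * ((int n - int (c + h)) * (int s - int h))) * qbin n (c + h) * qbin s (s - h))"
    by (simp only: sum_distrib_left)
  also have "(\<Sum>h\<le>s. qq (4 * ((int n - int (c + h)) * (int s - int h))) * qbin n (c + h) * qbin s (s - h))
      = (\<Sum>i\<in>{c..s + c}. qq (4 * ((int n - int i) * (int (s + c) - int i))) * qbin n i * qbin s (s + c - i))"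
    by (rule sum.reindex_bij_witness[of _ "\<lambda>i. i - c" "\<lambda>h. c + h"]) auto
  \<comment> \<open>The added terms have \<open>i < c\<close>, hence \<open>s + c - i > s\<close>,
    and vanish.\<close>
  also have "\<dots> = (\<Sum>i\<le>s + c. qq (4 * ((int n - int i) * (int (s + c) - int i))) * qbin n i * qbin s (s + c - i))"
    by (rule sum.mono_neutral_left) auto
  also have "\<dots> = qbin (n + s) (s + c)"
    by (rule qbin_Vandermonde'[symmetric])
  finally show ?thesis .
qed

subsection \<open>The Burge transform\<close>

definition burge :: "int \<Rightarrow> int \<Rightarrow> int \<Rightarrow> int \<Rightarrow> rat fls" where
  "burge L M a b = qbinom (L + M + a - b) (L + a) * qbinom (L + M - a + b) (L - a)"

lemma qbinom_sym: "qbinom n (n - k) = qbinom n k"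
  by (auto simp: qbinom_def)

text \<open>Complementing both lower entries exhibits the symmetry between \<open>(L, a)\<close> and
  \<open>(M, b)\<close>.\<close>

lemma burge_alt: "burge L M a b = qbinom (L + M + a - b) (M - b) * qbinom (L + M - a + b) (M + b)"
proof -
  have "L + M + a - b - (M - b) = L + a" "L + M - a + b - (M + b) = L - a" by simp_all
  then have "qbinom (L + M + a - b) (L + a) = qbinom (L + M + a - b) (M - b)"
    "qbinom (L + M - a + b) (L - a) = qbinom (L + M - a + b) (M + b)"
    by (metis qbinom_sym)+
  then show ?thesis by (simp only: burge_def)
qed

lemma burge_swap: "burge L M a b = burge M L b a"
  unfolding burge_alt[of L M a b] burge_def[of M L b a] by (simp add: algebra_simps)

lemma burge_minus: "burge L M (- a) (- b) = burge L M a b"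
  unfolding burge_def by (simp add: algebra_simps)

lemma qbinom_nz: "qbinom n k \<noteq> 0 \<Longrightarrow> 0 \<le> k \<and> k \<le> n"
  by (auto simp: qbinom_def split: if_splits)

text \<open>The four lower and complementary entries \<open>L + a\<close>, \<open>L - a\<close>,
  \<open>M - b\<close>, \<open>M + b\<close> must be nonnegative. Ranges of summation are adjusted
  by means of this bound.\<close>

lemma burge_nz: "burge L M a b \<noteq> 0 \<Longrightarrow> \<bar>a\<bar> \<le> L \<and> \<bar>b\<bar> \<le> M"
  using qbinom_nz[of "L + M + a - b" "L + a"] qbinom_nz[of "L + M - a + b" "L - a"]
  unfolding burge_def by auto

text \<open>With \<open>i = b + j\<close> this is \<open>qbin_Saalschuetz\<close> for
  \<open>m = L + a - b\<close>, \<open>n = L - a + b\<close>, \<open>s = M - b\<close>,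
  \<open>c = 2 b\<close>. When \<open>m\<close>, \<open>n\<close> or \<open>s\<close> would be
  negative, both sides vanish.\<close>

lemma burge_transform_nonneg:
  assumes "0 \<le> a" "0 \<le> b"
  shows "(\<Sum>i\<in>{0..L}. qq (4 * i\<^sup>2) * qbinom (2 * L + M - i) (2 * L) * burge (L - i) i a b)
    = qq (4 * b\<^sup>2) * burge L M (a + b) b"
proof (cases "\<bar>a - b\<bar> \<le> L \<and> b \<le> M")
  case False
  then have 1: "burge L M (a + b) b = 0"
    using assms burge_nz[of L M "a + b" b] by force
  have "qbinom (2 * L + M - i) (2 * L) * burge (L - i) i a b = 0" for i
  proof (rule ccontr)
    assume *: "qbinom (2 * L + M - i) (2 * L) * burge (L - i) i a b \<noteq> 0"
    then have "i \<le> M" using qbinom_nz[of "2 * L + M - i" "2 * L"] by auto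
    moreover have "\<bar>a\<bar> \<le> L - i \<and> \<bar>b\<bar> \<le> i" using * burge_nz by auto
    ultimately show False using False assms by linarith
  qed
  then have "qq (4 * i\<^sup>2) * qbinom (2 * L + M - i) (2 * L) * burge (L - i) i a b = 0" for i
    by (metis mult.assoc mult_zero_right)
  then show ?thesis unfolding 1 by (simp only: sum.neutral_const mult_zero_right)
next
  case True
  define m n s c where "m = nat (L + a - b)" and "n = nat (L - a + b)" and "s = nat (M - b)" and "c = nat (2 * b)"
  have [simp]: "int m = L + a - b" "int n = L - a + b" "int s = M - b" "int c = 2 * b"
    using True assms by (auto simp: m_def n_def s_def c_def)
  let ?t = "\<lambda>i. qq (4 * i\<^sup>2) * qbinom (2 * L + M - i) (2 * L) * burge (L - i) i a b"
  have nz: "b \<le> i \<and> i \<le> M \<and> i \<le> L" if "?t i \<noteq> 0" for i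
    using that assms qbinom_nz[of "2 * L + M - i" "2 * L"] burge_nz[of "L - i" i a b] by auto
  \<comment> \<open>Nonzero terms have \<open>b \<le> i \<le> M\<close> and
    \<open>i \<le> L\<close>; the detour through \<open>max L M\<close> is taken because neither of
    \<open>L\<close> and \<open>M\<close> bounds the other.\<close>
  have "(\<Sum>i\<in>{0..L}. ?t i) = (\<Sum>i\<in>{0..max L M}. ?t i)"
    using nz by (intro sum.mono_neutral_left) force+
  also have "\<dots> = (\<Sum>i\<in>{b..M}. ?t i)"
    using nz assms by (intro sum.mono_neutral_right) force+
  also have "\<dots> = (\<Sum>j\<le>s. ?t (b + int j))"
    using True unfolding s_def by (intro sum.reindex_bij_witness[of _ "\<lambda>j. b + int j" "\<lambda>i. nat (i - b)"]) auto
  also have "\<dots> = (\<Sum>j\<le>s. qq (4 * b\<^sup>2) * (qq (4 * (int j * (int j + int c))) * qbin (m + n + s - j) (m + n) * qbin m j * qbin n (j + c)))"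
  proof (rule sum.cong[OF refl])
    fix j assume "j \<in> {..s}"
    then have j: "j \<le> s" by simp
    have 1: "qq (4 * (b + int j)\<^sup>2) = qq (4 * b\<^sup>2) * qq (4 * (int j * (int j + int c)))"
      by (simp add: power2_eq_square algebra_simps flip: qq_add)
    have "int (m + n + s - j) = 2 * L + M - (b + int j)"
      using j by (simp add: of_nat_diff)
    then have 2: "qbinom (2 * L + M - (b + int j)) (2 * L) = qbin (m + n + s - j) (m + n)"
      by (simp add: qbin_def)
    have 3: "burge (L - (b + int j)) (b + int j) a b = qbin m j * qbin n (j + c)"
      unfolding burge_alt qbin_def by (simp add: algebra_simps)
    show "?t (b + int j) = qq (4 * b\<^sup>2) * (qq (4 * (int j * (int j + int c))) * qbin (m + n + s - j) (m + n) * qbin m j * qbin n (j + c))"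
      unfolding 1 2 3 by (simp add: mult_ac)
  qed
  also have "\<dots> = qq (4 * b\<^sup>2) * (qbin (m + s + c) s * qbin (n + s) (s + c))"
    by (simp only: qbin_Saalschuetz flip: sum_distrib_left)
  also have "qbin (m + s + c) s * qbin (n + s) (s + c) = burge L M (a + b) b"
    unfolding burge_alt qbin_def by (simp add: algebra_simps)
  finally show ?thesis .
qed

text \<open>The sign condition is essential: for \<open>a = -1\<close>, \<open>b = 1\<close>,
  \<open>L = M = 1\<close> the left side is 0 and the right side is not.\<close>

lemma burge_transform:
  assumes "0 \<le> a \<and> 0 \<le> b \<or> a \<le> 0 \<and> b \<le> 0"
  shows "(\<Sum>i\<in>{0..L}. qq (4 * i\<^sup>2) * qbinom (2 * L + M - i) (2 * L) * burge (L - i) i a b)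
    = qq (4 * b\<^sup>2) * burge L M (a + b) b"
  using assms
proof
  assume "a \<le> 0 \<and> b \<le> 0"
  then show ?thesis
    using burge_transform_nonneg[of "- a" "- b" L M] burge_minus[of _ _ a b] burge_minus[of L M "a + b" b]
    by simp
qed (use burge_transform_nonneg in blast)

subsection \<open>Summation to \<open>q\<close>-trinomial coefficients\<close>

text \<open>Reciprocals get a name so that \<open>algebra\<close> can treat them as ring elements,
  tied to \<open>qpoch\<close> by \<open>qpoch_inverse\<close>.\<close>

definition inv_qpoch :: "nat \<Rightarrow> rat fls" where
  "inv_qpoch n = inverse (qpoch n)"

lemma inv_qpoch_0 [simp]: "inv_qpoch 0 = 1"
  by (simp add: inv_qpoch_def)

lemma qpoch_inverse [simp]: "qpoch n * inv_qpoch n = 1"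
  by (simp add: inv_qpoch_def)

lemma qbin_nzD: "qbin n k \<noteq> 0 \<Longrightarrow> k \<le> n"
  using qbin_gt not_le by blast

lemma qbin_inv_qpoch: "k \<le> n \<Longrightarrow> qbin n k = qpoch n * inv_qpoch k * inv_qpoch (n - k)"
  by (simp add: qbin_eq inv_qpoch_def divide_inverse mult_ac)

lemma q_binomial:
  "(\<Prod>h<n. 1 - X * qq (4 * int h)) = (\<Sum>m\<le>n. (- X) ^ m * qq (2 * (int m * (int m - 1))) * qbin n m)"
proof (induction n)
  case (Suc n)
  let ?t = "\<lambda>n m. (- X) ^ m * qq (2 * (int m * (int m - 1))) * qbin n m"
  have e: "qq (2 * (int (Suc m) * (int (Suc m) - 1))) * qq (4 * (int n - int m))
      = qq (2 * (int m * (int m - 1))) * qq (4 * int n)" for m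
    by (simp add: algebra_simps flip: qq_add)
  have alg: "- X * p * x1 * (b + x2 * c) = - X * p * x1 * b + - (X * x4) * (p * x3 * c)" if "x1 * x2 = x3 * x4"
    for x1 x2 x3 x4 b c p :: "rat fls"
    using that by algebra
  have "(\<Sum>m\<le>Suc n. ?t (Suc n) m) = 1 + (\<Sum>m\<le>n. ?t (Suc n) (Suc m))"
    by (simp only: sum.atMost_Suc_shift) simp
  also have "(\<Sum>m\<le>n. ?t (Suc n) (Suc m)) = (\<Sum>m\<le>n. ?t n (Suc m) + - (X * qq (4 * int n)) * ?t n m)"
    unfolding qbin_Suc' power_Suc by (intro sum.cong refl alg e)
  also have "\<dots> = (\<Sum>m\<le>n. ?t n (Suc m)) + - (X * qq (4 * int n)) * (\<Sum>m\<le>n. ?t n m)"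
    by (simp only: sum.distrib sum_distrib_left)
  also have "1 + \<dots> = (1 + (\<Sum>m\<le>n. ?t n (Suc m))) + - (X * qq (4 * int n)) * (\<Sum>m\<le>n. ?t n m)"
    by (simp only: add.assoc)
  also have "1 + (\<Sum>m\<le>n. ?t n (Suc m)) = (\<Sum>m\<le>Suc n. ?t n m)"
    by (simp only: sum.atMost_Suc_shift) simp
  also have "\<dots> = (\<Sum>m\<le>n. ?t n m)" by simp
  also have "(\<Sum>m\<le>n. ?t n m) + - (X * qq (4 * int n)) * (\<Sum>m\<le>n. ?t n m) = (\<Sum>m\<le>n. ?t n m) * (1 - X * qq (4 * int n))"
    by (simp add: algebra_simps)
  finally show ?case using Suc by simp
qed simp

lemma q_binomial_1: "(\<Sum>m\<le>n. (- 1) ^ m * qq (2 * (int m * (int m - 1))) * qbin n m) = (if n = 0 then 1 else 0)"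
proof (cases n)
  case (Suc k)
  have "(\<Prod>h<n. 1 - 1 * qq (4 * int h)) = 0"
    unfolding Suc by (subst prod.lessThan_Suc_shift) simp
  then have "(\<Sum>m\<le>n. (- 1) ^ m * qq (2 * (int m * (int m - 1))) * qbin n m) = 0"
    by (simp only: q_binomial)
  then show ?thesis using Suc by (simp only: nat.simps if_False)
qed simp

lemma qpoch_add: "qpoch (n + y) = qpoch n * (\<Prod>h<y. 1 - qq (4 * (1 + int n)) * qq (4 * int h))"
proof (induction y)
  case (Suc y)
  have "qpoch (n + Suc y) = qpoch (n + y) * (1 - qq (4 * (1 + int n)) * qq (4 * int y))"
    by (simp add: qpoch_Suc algebra_simps flip: qq_add)
  then show ?case by (simp add: Suc mult.assoc)
qed simp

text \<open>\<open>[n+y; y]\<close> is the product of the \<open>1 - q^(n+1+h)\<close> over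
  \<open>h < y\<close>, divided by \<open>(q)_y\<close>; the \<open>q\<close>-binomial theorem makes
  it a polynomial in \<open>q^n\<close> with coefficients free of \<open>n\<close>.\<close>

lemma qbin_expand:
  "qbin (n + y) y = (\<Sum>f\<le>y. (- 1) ^ f * qq (4 * (int f * (int n + 1)) + 2 * (int f * (int f - 1))) * inv_qpoch f * inv_qpoch (y - f))"
proof -
  have p: "(- qq a) ^ f = (- 1) ^ f * qq (int f * a)" for a f
    by (induction f) (simp_all add: algebra_simps qq_add)
  have "qbin (n + y) y = inv_qpoch y * (\<Prod>h<y. 1 - qq (4 * (1 + int n)) * qq (4 * int h))"
    by (simp add: qbin_eq qpoch_add inv_qpoch_def divide_inverse)
  also have "\<dots> = (\<Sum>f\<le>y. inv_qpoch y * ((- qq (4 * (1 + int n))) ^ f * qq (2 * (int f * (int f - 1))) * qbin y f))"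
    unfolding q_binomial by (rule sum_distrib_left)
  also have "\<dots> = (\<Sum>f\<le>y. (- 1) ^ f * qq (4 * (int f * (int n + 1)) + 2 * (int f * (int f - 1))) * inv_qpoch f * inv_qpoch (y - f))"
  proof (rule sum.cong[OF refl])
    fix f assume "f \<in> {..y}"
    then have "f \<le> y" by simp
    have e: "qq (int f * (4 * (1 + int n))) = qq (4 * (int f * (int n + 1)))"
      by (simp add: algebra_simps)
    have alg: "i * (s * x1 * x2 * (c * i1 * i2)) = s * (x1 * x2) * i1 * i2" if "c * i = 1" for i s x1 x2 c i1 i2 :: "rat fls"
      using that by algebra
    show "inv_qpoch y * ((- qq (4 * (1 + int n))) ^ f * qq (2 * (int f * (int f - 1))) * qbin y f)
       = (- 1) ^ f * qq (4 * (int f * (int n + 1)) + 2 * (int f * (int f - 1))) * inv_qpoch f * inv_qpoch (y - f)"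
      unfolding p e qbin_inv_qpoch[OF \<open>f \<le> y\<close>] qq_add by (rule alg[OF qpoch_inverse])
  qed
  finally show ?thesis .
qed

text \<open>This is \<open>qbin_Vandermonde'\<close> for \<open>[g+n; K]\<close> in the limit of
  large \<open>n\<close>, where \<open>[n; K-j]\<close> tends to \<open>1 / (q)_(K-j)\<close>. The
  induction on \<open>g\<close> avoids the limit.\<close>

lemma sum_qbin_inv_qpoch:
  "(\<Sum>j\<le>K. qq (4 * ((int K - int j) * (int g - int j))) * qbin g j * inv_qpoch (K - j)) = inv_qpoch K"
proof (induction g arbitrary: K)
  case 0
  have "(\<Sum>j\<le>K. qq (4 * ((int K - int j) * (int 0 - int j))) * qbin 0 j * inv_qpoch (K - j)) = (\<Sum>j\<le>K. if j = 0 then inv_qpoch K else 0)"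
    by (intro sum.cong) auto
  then show ?case by simp
next
  case (Suc g)
  show ?case
  proof (cases K)
    case (Suc l)
    let ?t = "\<lambda>K j. qq (4 * ((int K - int j) * (int g - int j))) * qbin g j * inv_qpoch (K - j)"
    have e: "qq (4 * ((int (Suc l) - int (Suc j)) * (int (Suc g) - int (Suc j)))) = qq (4 * ((int l - int j) * (int g - int j)))" for j
      by simp
    have e2: "qq (4 * ((int l - int j) * (int g - int j))) * qq (4 * (1 + int j)) = qq (4 * (1 + int l)) * qq (4 * ((int (Suc l) - int (Suc j)) * (int g - int (Suc j))))" for j
      by (simp add: algebra_simps flip: qq_add)
    have e3: "qq (4 * ((int (Suc l) - int 0) * (int (Suc g) - int 0))) = qq (4 * (1 + int l)) * qq (4 * ((int (Suc l) - int 0) * (int g - int 0)))"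
      by (simp add: algebra_simps flip: qq_add)
    have alg: "x1 * (b + x2 * c) * i = x1 * b * i + x3 * (x4 * c * i)" if "x1 * x2 = x3 * x4"
      for x1 x2 x3 x4 b c i :: "rat fls"
      using that by algebra
    have "(\<Sum>j\<le>K. qq (4 * ((int K - int j) * (int (Suc g) - int j))) * qbin (Suc g) j * inv_qpoch (K - j))
        = qq (4 * (1 + int l)) * ?t K 0 + (\<Sum>j\<le>l. qq (4 * ((int l - int j) * (int g - int j))) * qbin (Suc g) (Suc j) * inv_qpoch (l - j))"
      unfolding Suc sum.atMost_Suc_shift e3 e by simp
    also have "(\<Sum>j\<le>l. qq (4 * ((int l - int j) * (int g - int j))) * qbin (Suc g) (Suc j) * inv_qpoch (l - j))
        = (\<Sum>j\<le>l. ?t l j + qq (4 * (1 + int l)) * ?t K (Suc j))"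
      unfolding qbin_Suc Suc diff_Suc_Suc by (intro sum.cong refl alg e2)
    also have "\<dots> = inv_qpoch l + qq (4 * (1 + int l)) * (\<Sum>j\<le>l. ?t K (Suc j))"
      by (simp only: sum.distrib sum_distrib_left Suc.IH)
    also have "qq (4 * (1 + int l)) * ?t K 0 + \<dots> = inv_qpoch l + qq (4 * (1 + int l)) * (?t K 0 + (\<Sum>j\<le>l. ?t K (Suc j)))"
      by (simp only: distrib_left add_ac)
    also have "?t K 0 + (\<Sum>j\<le>l. ?t K (Suc j)) = (\<Sum>j\<le>K. ?t K j)"
      by (simp only: Suc sum.atMost_Suc_shift)
    also have "\<dots> = inv_qpoch K" by (rule Suc.IH)
    also have "inv_qpoch l + qq (4 * (1 + int l)) * inv_qpoch K = inv_qpoch K"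
    proof -
      have "inv_qpoch l = (1 - qq (4 * (1 + int l))) * inv_qpoch K"
        using qpoch_nz[of "Suc l"] by (simp add: Suc inv_qpoch_def qpoch_Suc)
      then show ?thesis by (simp add: algebra_simps)
    qed
    finally show ?thesis .
  qed simp
qed

lemma sum_sum_Sigma: "finite A \<Longrightarrow> (\<And>x. x \<in> A \<Longrightarrow> finite (B x)) \<Longrightarrow> (\<Sum>x\<in>A. \<Sum>y\<in>B x. f (x, y)) = sum f (Sigma A B)"
  by (simp add: sum.Sigma)

section \<open>Multiple sums over \<open>k + 2 y = N\<close> and
  \<open>x + k + 2 y = N\<close>\<close>

definition pairs :: "nat \<Rightarrow> (nat \<times> nat) set" where
  "pairs N = {(k, y). k + 2 * y = N}"

definition triples :: "nat \<Rightarrow> (nat \<times> nat \<times> nat) set" where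
  "triples N = {(x, k, y). x + k + 2 * y = N}"

lemma finite_pairs [simp]: "finite (pairs N)"
  by (rule finite_subset[of _ "{..N} \<times> {..N}"]) (auto simp: pairs_def)

lemma finite_triples [simp]: "finite (triples N)"
  by (rule finite_subset[of _ "{..N} \<times> {..N} \<times> {..N}"]) (auto simp: triples_def)

text \<open>Put \<open>p = z + f\<close>, so that \<open>n - p = m + f\<close>. Trinomial revision
  rewrites the binomial part as \<open>[p; n-p] [n-p; m] / (q)_p\<close>, the sum over
  \<open>m\<close> becomes the alternating sum of \<open>q_binomial_1\<close>, and only
  \<open>p = n\<close> survives.\<close>

lemma sum_triples_qbin:
  "(\<Sum>(z, m, f)\<in>triples n. (- 1) ^ f * qq (2 * (int z + int f)\<^sup>2 + 2 * (int m)\<^sup>2 + 2 * int f) * qbin z m * inv_qpoch z * inv_qpoch f)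
    = qq (2 * (int n)\<^sup>2) * inv_qpoch n"
proof -
  let ?h = "\<lambda>(p, m). qq (2 * (int p)\<^sup>2) * inv_qpoch p * qbin p (n - p) * (- 1) ^ (n - p) * qq (2 * (int n - int p))
      * ((- 1) ^ m * qq (2 * (int m * (int m - 1))) * qbin (n - p) m)"
  let ?i = "\<lambda>(p, m). (p - (n - p - m), m, n - p - m)" and ?j = "\<lambda>(z, m, f). (z + f, m)"
  have "(\<Sum>(z, m, f)\<in>triples n. (- 1) ^ f * qq (2 * (int z + int f)\<^sup>2 + 2 * (int m)\<^sup>2 + 2 * int f) * qbin z m * inv_qpoch z * inv_qpoch f)
      = sum ?h {(p, m). p \<le> n \<and> m \<le> n - p \<and> n - p - m \<le> p}"
  proof (rule sum.reindex_bij_witness[of _ ?i ?j])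
    fix v assume "v \<in> triples n"
    then obtain z m f where v: "v = (z, m, f)" and n: "n = z + m + 2 * f"
      by (auto simp: triples_def)
    have d: "n - (z + f) = m + f" "int n - (int z + int f) = int m + int f" "int (z + f) = int z + int f"
      by (simp_all add: n)
    have "qbin (z + f) f * qbin z m = qbin (z + f) (f + m) * qbin (f + m) m"
      using qbin_trinomial[of "z + f" f m] by simp
    moreover have "qbin (z + f) f = qpoch (z + f) * inv_qpoch f * inv_qpoch z" using qbin_inv_qpoch[of f "z + f"] by simp
    ultimately have 1: "qbin z m * inv_qpoch z * inv_qpoch f = inv_qpoch (z + f) * qbin (z + f) (m + f) * qbin (m + f) m"
      using qpoch_inverse[of "z + f"] unfolding add.commute[of m f] by algebra
    have alg: "x1 * i * q1 * s1 * x2 * (s2 * x3 * q2) = s1 * s2 * (x1 * x2 * x3) * q3 * i1 * i2"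
      if "q3 * i1 * i2 = i * q1 * q2" for x1 x2 x3 i i1 i2 q1 q2 q3 s1 s2 :: "rat fls"
      using that by algebra
    have s: "(- 1) ^ (m + f) * (- 1) ^ m = ((- 1) ^ f :: rat fls)"
      by (auto simp: minus_one_power_iff)
    have e: "qq (2 * (int z + int f)\<^sup>2 + 2 * (int m)\<^sup>2 + 2 * int f)
        = qq (2 * (int z + int f)\<^sup>2) * qq (2 * (int m + int f)) * qq (2 * (int m * (int m - 1)))"
      by (simp add: algebra_simps power2_eq_square flip: qq_add)
    show "?h (?j v) = (case v of (z, m, f) \<Rightarrow>
        (- 1) ^ f * qq (2 * (int z + int f)\<^sup>2 + 2 * (int m)\<^sup>2 + 2 * int f) * qbin z m * inv_qpoch z * inv_qpoch f)"
      unfolding v prod.case d e s[symmetric] by (rule alg[OF 1])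
  qed (auto simp: triples_def)
  \<comment> \<open>The added pairs satisfy \<open>n - p > p\<close>, where
    \<open>qbin p (n - p)\<close> is 0.\<close>
  also have "\<dots> = sum ?h (SIGMA p:{..n}. {..n - p})"
    by (rule sum.mono_neutral_left) (auto dest!: qbin_nzD)
  also have "\<dots> = (\<Sum>p\<le>n. \<Sum>m\<le>n - p. ?h (p, m))"
    by (rule sum_sum_Sigma[symmetric]) auto
  also have "\<dots> = (\<Sum>p\<le>n. qq (2 * (int p)\<^sup>2) * inv_qpoch p * qbin p (n - p) * (- 1) ^ (n - p) * qq (2 * (int n - int p)) * (if n - p = 0 then 1 else 0))"
    unfolding prod.case q_binomial_1[symmetric] sum_distrib_left ..
  also have "\<dots> = (\<Sum>p\<le>n. if p = n then qq (2 * (int n)\<^sup>2) * inv_qpoch n else 0)"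
    by (intro sum.cong) auto
  finally show ?thesis by simp
qed

lemma pairs_iff [simp]: "(k, y) \<in> pairs N \<longleftrightarrow> k + 2 * y = N"
  by (simp add: pairs_def)

text \<open>\<open>[g+z; k]\<close> is expanded by Vandermonde with index \<open>m\<close>,
  \<open>[g+b+z+y; y]\<close> by \<open>qbin_expand\<close> with index \<open>f\<close>. For fixed
  \<open>n = z + m + 2 f\<close> the sum over \<open>(z, m, f)\<close> is
  \<open>sum_triples_qbin\<close>; the remaining one is \<open>sum_qbin_inv_qpoch\<close>. By
  \<open>g = b + c\<close> the cross term \<open>4 f (c + g + b)\<close> equals
  \<open>8 f g\<close>, as the weight \<open>4 g n\<close> demands, and \<open>b\<close> drops
  out.\<close>

lemma sum_triples_two_qbin:
  assumes g: "g = b + c"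
  shows "(\<Sum>(z, k, y)\<in>triples N. qq (2 * (int z)\<^sup>2 + 4 * int g * int z + 2 * (int k)\<^sup>2 + 4 * int c * int y)
      * qbin (g + z) k * qbin (g + b + z + y) y * inv_qpoch z)
    = (\<Sum>(k, y)\<in>pairs N. qq (2 * (int k)\<^sup>2 + 4 * int c * int y) * inv_qpoch k * inv_qpoch y)"
proof -
  let ?A = "\<lambda>(z, k, y). qq (2 * (int z)\<^sup>2 + 4 * int g * int z + 2 * (int k)\<^sup>2 + 4 * int c * int y)"
  let ?P = "\<lambda>(z, k, y) m. qq (4 * (int m * (int g - int k + int m))) * qbin g (k - m) * qbin z m"
  let ?Q = "\<lambda>(z, k, y) f. (- 1) ^ f * qq (4 * (int f * (int (g + b + z) + 1)) + 2 * (int f * (int f - 1))) * inv_qpoch f * inv_qpoch (y - f)"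
  let ?F = "\<lambda>(v, m, f). ?A v * ?P v m * ?Q v f * (inv_qpoch (fst v))"
  let ?M = "\<lambda>(z, m, f). (- 1) ^ f * qq (2 * (int z + int f)\<^sup>2 + 2 * (int m)\<^sup>2 + 2 * int f) * qbin z m * inv_qpoch z * inv_qpoch f"
  let ?R = "\<lambda>(n, k, y). qq (2 * (int k)\<^sup>2 + 4 * int c * int y + 4 * int g * int n) * qbin g k * inv_qpoch y"
  let ?H = "\<lambda>((K, y), k). ?R (K - k, k, y) * (qq (2 * (int (K - k))\<^sup>2) * inv_qpoch (K - k))"
  let ?i = "\<lambda>((n, k, y), (z, m, f)). ((z, k + m, y + f), (m, f))"
    and ?j = "\<lambda>((z, k, y), (m, f)). ((z + m + 2 * f, k - m, y - f), (z, m, f))"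
  have "(\<Sum>(z, k, y)\<in>triples N. qq (2 * (int z)\<^sup>2 + 4 * int g * int z + 2 * (int k)\<^sup>2 + 4 * int c * int y)
      * qbin (g + z) k * qbin (g + b + z + y) y * inv_qpoch z)
     = (\<Sum>v\<in>triples N. \<Sum>mf\<in>{..fst (snd v)} \<times> {..snd (snd v)}. ?F (v, mf))"
  proof (rule sum.cong[OF refl])
    fix v :: "nat \<times> nat \<times> nat"
    obtain z k y where v: "v = (z, k, y)" by (cases v)
    have 1: "qbin (g + z) k = (\<Sum>m\<le>k. ?P (z, k, y) m)"
      using qbin_Vandermonde[of g z k] by simp
    have 2: "qbin (g + b + z + y) y = (\<Sum>f\<le>y. ?Q (z, k, y) f)"
      using qbin_expand[of "g + b + z" y] by simp
    have "?A v * (\<Sum>m\<le>k. ?P v m) * (\<Sum>f\<le>y. ?Q v f) * inv_qpoch z = (\<Sum>m\<le>k. \<Sum>f\<le>y. ?A v * ?P v m * ?Q v f * inv_qpoch z)"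
      by (simp only: sum_distrib_left sum_distrib_right) (rule sum.swap)
    then show "(case v of (z, k, y) \<Rightarrow> qq (2 * (int z)\<^sup>2 + 4 * int g * int z + 2 * (int k)\<^sup>2 + 4 * int c * int y)
      * qbin (g + z) k * qbin (g + b + z + y) y * inv_qpoch z) = (\<Sum>mf\<in>{..fst (snd v)} \<times> {..snd (snd v)}. ?F (v, mf))"
      unfolding v prod.case 1 2 fst_conv snd_conv sum.cartesian_product by (simp only: prod.case fst_conv)
  qed
  also have "\<dots> = sum ?F (SIGMA v:triples N. {..fst (snd v)} \<times> {..snd (snd v)})"
    by (intro sum_sum_Sigma) auto
  also have "\<dots> = sum (\<lambda>(w, v). ?R w * ?M v) (SIGMA w:triples N. triples (fst w))"
  proof (rule sum.reindex_bij_witness[of _ ?i ?j])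
    fix u assume "u \<in> (SIGMA v:triples N. {..fst (snd v)} \<times> {..snd (snd v)})"
    then obtain z k y m f where u: "u = ((z, k + m, y + f), (m, f))"
      by (auto simp: triples_def) (metis le_add_diff_inverse2)
    have e: "qq (2 * (int k)\<^sup>2 + 4 * int c * int y + 4 * int g * int (z + m + 2 * f)) * qq (2 * (int z + int f)\<^sup>2 + 2 * (int m)\<^sup>2 + 2 * int f)
      = qq (2 * (int z)\<^sup>2 + 4 * int g * int z + 2 * (int (k + m))\<^sup>2 + 4 * int c * int (y + f))
       * qq (4 * (int m * (int g - int (k + m) + int m))) * qq (4 * (int f * (int (g + b + z) + 1)) + 2 * (int f * (int f - 1)))"
      unfolding g by (simp add: algebra_simps power2_eq_square flip: qq_add)
    have alg: "x1 * q1 * i1 * (s * x2 * q2 * i2 * i3) = x3 * (x4 * q1 * q2) * (s * x5 * i3 * i1) * i2"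
      if "x1 * x2 = x3 * x4 * x5" for x1 x2 x3 x4 x5 i1 i2 i3 q1 q2 s :: "rat fls"
      using that by algebra
    show "(case ?j u of (w, v) \<Rightarrow> ?R w * ?M v) = ?F u"
      unfolding u prod.case fst_conv add_diff_cancel_right' by (rule alg[OF e])
  qed (auto simp: triples_def)
  also have "\<dots> = (\<Sum>w\<in>triples N. \<Sum>v\<in>triples (fst w). ?R w * ?M v)"
    by (simp add: sum.Sigma)
  also have "\<dots> = (\<Sum>w\<in>triples N. ?R w * (qq (2 * (int (fst w))\<^sup>2) * inv_qpoch (fst w)))"
    unfolding sum_distrib_left[symmetric] sum_triples_qbin ..
  also have "\<dots> = sum ?H (SIGMA v:pairs N. {..fst v})"
    by (rule sum.reindex_bij_witness[of _ "\<lambda>((K, y), k). (K - k, k, y)" "\<lambda>(n, k, y). ((n + k, y), k)"])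
       (auto simp: pairs_def triples_def)
  also have "\<dots> = (\<Sum>v\<in>pairs N. \<Sum>k\<le>fst v. ?H (v, k))"
    using sum_sum_Sigma[of "pairs N" "\<lambda>v. {..fst v}" ?H] by simp
  also have "\<dots> = (\<Sum>v\<in>pairs N. qq (2 * (int (fst v))\<^sup>2 + 4 * int c * int (snd v)) * inv_qpoch (snd v)
      * (\<Sum>k\<le>fst v. qq (4 * ((int (fst v) - int k) * (int g - int k))) * qbin g k * inv_qpoch (fst v - k)))"
  proof (rule sum.cong[OF refl])
    fix v :: "nat \<times> nat"
    obtain K y where v: "v = (K, y)" by (cases v)
    show "(\<Sum>k\<le>fst v. ?H (v, k)) = qq (2 * (int (fst v))\<^sup>2 + 4 * int c * int (snd v)) * inv_qpoch (snd v)
      * (\<Sum>k\<le>fst v. qq (4 * ((int (fst v) - int k) * (int g - int k))) * qbin g k * inv_qpoch (fst v - k))"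
      unfolding sum_distrib_left v fst_conv snd_conv
    proof (rule sum.cong[OF refl])
      fix k assume "k \<in> {..K}"
      then obtain n where n: "K = n + k" by (metis atMost_iff le_add_diff_inverse2)
      have e: "qq (2 * (int k)\<^sup>2 + 4 * int c * int y + 4 * int g * int n) * qq (2 * (int n)\<^sup>2)
          = qq (2 * (int (n + k))\<^sup>2 + 4 * int c * int y) * qq (4 * ((int (n + k) - int k) * (int g - int k)))"
        by (simp add: algebra_simps power2_eq_square flip: qq_add)
      have alg: "x1 * q * i1 * (x2 * i2) = x3 * i1 * (x4 * q * i2)" if "x1 * x2 = x3 * x4" for x1 x2 x3 x4 q i1 i2 :: "rat fls"
        using that by algebra
      show "?H ((K, y), k) = qq (2 * (int K)\<^sup>2 + 4 * int c * int y) * inv_qpoch y * (qq (4 * ((int K - int k) * (int g - int k))) * qbin g k * inv_qpoch (K - k))"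
        unfolding n prod.case add_diff_cancel_right' by (rule alg[OF e])
    qed
  qed
  also have "\<dots> = (\<Sum>(k, y)\<in>pairs N. qq (2 * (int k)\<^sup>2 + 4 * int c * int y) * inv_qpoch k * inv_qpoch y)"
    unfolding sum_qbin_inv_qpoch by (simp add: split_beta mult_ac)
  finally show ?thesis .
qed

text \<open>Vandermonde splits \<open>[A+r; c]\<close> into products \<open>[r; e] [A; c-e]\<close>.
  With \<open>g = c - e\<close>, the variables \<open>k = r - e + g\<close> and
  \<open>y = A - g\<close> satisfy \<open>k + 2 y = N - c\<close>, and the sum over \<open>g\<close>
  is \<open>sum_qbin_inv_qpoch\<close>.\<close>

lemma sum_pairs_qbin:
  assumes "c \<le> N"
  shows "(\<Sum>(r, A)\<in>pairs N. qq (2 * (int r)\<^sup>2 + 4 * int c * int A) * qbin (A + r) c * inv_qpoch r * inv_qpoch A)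
    = qq (2 * (int c)\<^sup>2) * inv_qpoch c * (\<Sum>(k, y)\<in>pairs (N - c). qq (2 * (int k)\<^sup>2 + 4 * int c * int y) * inv_qpoch k * inv_qpoch y)"
proof -
  let ?L = "\<lambda>((r, A), e). qq (2 * (int r)\<^sup>2 + 4 * int c * int A) * inv_qpoch r * inv_qpoch A * (qq (4 * ((int r - int e) * (int c - int e))) * qbin r e * qbin A (c - e))"
  let ?R = "\<lambda>((k, y), g). qq (2 * (int c)\<^sup>2) * inv_qpoch c * (qq (2 * (int k)\<^sup>2 + 4 * int c * int y) * inv_qpoch y) * (qq (4 * ((int k - int g) * (int c - int g))) * qbin c g * inv_qpoch (k - g))"
  let ?i = "\<lambda>((k, y), g). ((k - g + (c - g), g + y), c - g)"
    and ?j = "\<lambda>((r, A), e). ((r - e + (c - e), A - (c - e)), c - e)"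
  have "(\<Sum>(r, A)\<in>pairs N. qq (2 * (int r)\<^sup>2 + 4 * int c * int A) * qbin (A + r) c * inv_qpoch r * inv_qpoch A) = (\<Sum>v\<in>pairs N. \<Sum>e\<le>c. ?L (v, e))"
  proof (rule sum.cong[OF refl])
    fix v :: "nat \<times> nat"
    obtain r A where v: "v = (r, A)" by (cases v)
    show "(case v of (r, A) \<Rightarrow> qq (2 * (int r)\<^sup>2 + 4 * int c * int A) * qbin (A + r) c * inv_qpoch r * inv_qpoch A) = (\<Sum>e\<le>c. ?L (v, e))"
      unfolding v add.commute[of A r] qbin_Vandermonde'[of r A] prod.case sum_distrib_left[symmetric] by (simp only: mult_ac)
  qed
  also have "\<dots> = sum ?L (pairs N \<times> {..c})"
    by (intro sum_sum_Sigma) auto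
  also have "\<dots> = sum ?L {((r, A), e). r + 2 * A = N \<and> e \<le> c \<and> e \<le> r \<and> c - e \<le> A}"
    by (rule sum.mono_neutral_right) (auto dest!: qbin_nzD)
  also have "\<dots> = sum ?R {((k, y), g). k + 2 * y = N - c \<and> g \<le> k \<and> g \<le> c}"
  proof (rule sum.reindex_bij_witness[of _ ?i ?j])
    fix u assume "u \<in> {((r, A), e). r + 2 * A = N \<and> e \<le> c \<and> e \<le> r \<and> c - e \<le> A}"
    then obtain r A e where u': "u = ((r, A), e)" and *: "e \<le> c" "e \<le> r" "c - e \<le> A" by auto
    define r' g A' where "r' = r - e" and "g = c - e" and "A' = A - g"
    have u: "u = ((r' + e, A' + g), e)" and c: "c = g + e"
      using * by (auto simp: u' r'_def g_def A'_def)
    have e: "qq (2 * (int (g + e))\<^sup>2) * qq (2 * (int (r' + g))\<^sup>2 + 4 * int (g + e) * int A') * qq (4 * ((int (r' + g) - int g) * (int (g + e) - int g)))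
        = qq (2 * (int (r' + e))\<^sup>2 + 4 * int (g + e) * int (A' + g)) * qq (4 * ((int (r' + e) - int e) * (int (g + e) - int e)))"
      by (simp add: algebra_simps power2_eq_square flip: qq_add)
    have alg1: "i * (q * x * y) = y * x" "i * (q * y * x) = y * x" if "q * i = 1" for i q x y :: "rat fls"
      using that by algebra+
    \<comment> \<open>Either side has the factorial part
      \<open>1 / ((q)_r' (q)_e (q)_A' (q)_g)\<close>.\<close>
    have 1: "inv_qpoch (m + n) * qbin (m + n) n = inv_qpoch m * inv_qpoch n" "inv_qpoch (m + n) * qbin (m + n) m = inv_qpoch m * inv_qpoch n" for m n
      using alg1[OF qpoch_inverse] by (simp_all only: qbin_inv_qpoch le_add1 le_add2 add_diff_cancel_left' add_diff_cancel_right')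
    have alg: "x1 * i1 * (x2 * i2) * (x3 * q1 * i3) = x4 * i4 * i5 * (x5 * q2 * q3)"
      if "x1 * x2 * x3 = x4 * x5" "i1 * q1 = i6 * i7" "i4 * q2 = i3 * i7" "i5 * q3 = i2 * i6"
      for x1 x2 x3 x4 x5 i1 i2 i3 i4 i5 i6 i7 q1 q2 q3 :: "rat fls"
    proof -
      have "x1 * i1 * (x2 * i2) * (x3 * q1 * i3) = (x1 * x2 * x3) * (i1 * q1) * (i2 * i3)" by (simp only: mult_ac)
      also have "\<dots> = (x4 * x5) * (i4 * q2) * (i5 * q3)" unfolding that by (simp only: mult_ac)
      finally show ?thesis by (simp only: mult_ac)
    qed
    show "?R (?j u) = ?L u"
      unfolding u c prod.case add_diff_cancel_right' by (rule alg[OF e 1(2) 1(1) 1(1)])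
  qed (use assms in auto)
  also have "\<dots> = sum ?R (SIGMA v:pairs (N - c). {..fst v})"
    by (rule sum.mono_neutral_left) (auto dest!: qbin_nzD)
  also have "\<dots> = (\<Sum>(k, y)\<in>pairs (N - c). \<Sum>g\<le>k. ?R ((k, y), g))"
    by (simp add: sum.Sigma split_beta)
  also have "\<dots> = (\<Sum>(k, y)\<in>pairs (N - c). qq (2 * (int c)\<^sup>2) * inv_qpoch c * (qq (2 * (int k)\<^sup>2 + 4 * int c * int y) * inv_qpoch y) * inv_qpoch k)"
    unfolding prod.case sum_distrib_left[symmetric] sum_qbin_inv_qpoch ..
  also have "\<dots> = qq (2 * (int c)\<^sup>2) * inv_qpoch c * (\<Sum>(k, y)\<in>pairs (N - c). qq (2 * (int k)\<^sup>2 + 4 * int c * int y) * inv_qpoch k * inv_qpoch y)"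
    unfolding sum_distrib_left by (intro sum.cong refl) (auto simp: mult_ac)
  finally show ?thesis .
qed

text \<open>
  Expanding \<open>[a+x+y; x]\<close> in powers of \<open>q^a\<close> separates \<open>a\<close> from \<open>b\<close>; the coefficient sums then do not
  depend on \<open>b\<close>, so that only \<open>a + b\<close> survives.
\<close>

lemma refined_trinomial_sum:
  "(\<Sum>(x, k, y)\<in>triples N. qq (2 * (int x)\<^sup>2 + 2 * (int k)\<^sup>2 + 4 * int b * int x)
      * qbin (b + x) k * qbin (a + x + y) x * qbin (2 * b + x + y) y)
    = (\<Sum>(r, A)\<in>pairs N. qq (2 * (int r)\<^sup>2) * qpoch (N + a + b) * inv_qpoch r * inv_qpoch A * inv_qpoch (A + a + b))"
proof -
  let ?c = "\<lambda>c. (- 1) ^ c * qq (4 * int c * int (a + b) + 2 * (int c * (int c + 1)))"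
  let ?l = "\<lambda>(x, k, y). qq (2 * (int x)\<^sup>2 + 2 * (int k)\<^sup>2 + 4 * int b * int x) * qbin (b + x) k * qbin (a + x + y) x * qbin (2 * b + x + y) y"
  let ?r = "\<lambda>(r, A). qq (2 * (int r)\<^sup>2) * qpoch (N + a + b) * inv_qpoch r * inv_qpoch A * inv_qpoch (A + a + b)"
  let ?F = "\<lambda>((x, k, y), c). qq (2 * (int x)\<^sup>2 + 2 * (int k)\<^sup>2 + 4 * int b * int x) * qbin (b + x) k * qbin (2 * b + x + y) y
      * ((- 1) ^ c * qq (4 * (int c * (int (a + y) + 1)) + 2 * (int c * (int c - 1))) * inv_qpoch c * inv_qpoch (x - c))"
  let ?C = "\<lambda>c (z, k, y). qq (2 * (int z)\<^sup>2 + 4 * int (b + c) * int z + 2 * (int k)\<^sup>2 + 4 * int c * int y)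
      * qbin (b + c + z) k * qbin (b + c + b + z + y) y * inv_qpoch z"
  let ?G = "\<lambda>(c, v). ?c c * qq (2 * (int c)\<^sup>2) * inv_qpoch c * ?C c v"
  let ?R = "\<lambda>c (r, A). qq (2 * (int r)\<^sup>2 + 4 * int c * int A) * qbin (A + r) c * inv_qpoch r * inv_qpoch A"
  have "sum ?l (triples N) = (\<Sum>v\<in>triples N. \<Sum>c\<le>fst v. ?F (v, c))"
  proof (rule sum.cong[OF refl])
    fix v :: "nat \<times> nat \<times> nat"
    obtain x k y where v: "v = (x, k, y)" by (cases v)
    have 1: "qbin (a + x + y) x = (\<Sum>c\<le>x. (- 1) ^ c * qq (4 * (int c * (int (a + y) + 1)) + 2 * (int c * (int c - 1))) * inv_qpoch c * inv_qpoch (x - c))"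
      using qbin_expand[of "a + y" x] by (simp add: add_ac)
    show "?l v = (\<Sum>c\<le>fst v. ?F (v, c))"
      unfolding v prod.case fst_conv sum_distrib_left[symmetric] 1[symmetric] by (simp only: mult_ac)
  qed
  also have "\<dots> = sum ?F (SIGMA v:triples N. {..fst v})"
    by (intro sum_sum_Sigma) auto
  also have "\<dots> = sum ?G (SIGMA c:{..N}. triples (N - c))"
  proof (rule sum.reindex_bij_witness[of _ "\<lambda>(c, (z, k, y)). ((c + z, k, y), c)" "\<lambda>((x, k, y), c). (c, (x - c, k, y))"])
    fix u assume "u \<in> (SIGMA v:triples N. {..fst v})"
    then obtain x k y c where u': "u = ((x, k, y), c)" and "c \<le> x" by auto
    then obtain z where u: "u = ((c + z, k, y), c)" using le_Suc_ex by blast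
    have e: "qq (4 * int c * int (a + b) + 2 * (int c * (int c + 1))) * qq (2 * (int c)\<^sup>2) * qq (2 * (int z)\<^sup>2 + 4 * int (b + c) * int z + 2 * (int k)\<^sup>2 + 4 * int c * int y)
      = qq (2 * (int (c + z))\<^sup>2 + 2 * (int k)\<^sup>2 + 4 * int b * int (c + z)) * qq (4 * (int c * (int (a + y) + 1)) + 2 * (int c * (int c - 1)))"
      by (simp add: algebra_simps power2_eq_square flip: qq_add)
    have alg: "s * x1 * x2 * i1 * (x3 * q1 * q2 * i2) = x4 * q1 * q2 * (s * x5 * i1 * i2)"
      if "x1 * x2 * x3 = x4 * x5" for s x1 x2 x3 x4 x5 i1 i2 q1 q2 :: "rat fls"
      using that by algebra
    have b: "b + (c + z) = b + c + z" "2 * b + (c + z) + y = b + c + b + z + y" by simp_all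
    show "?G ((\<lambda>((x, k, y), c). (c, (x - c, k, y))) u) = ?F u"
      unfolding u prod.case add_diff_cancel_left' b by (rule alg[OF e])
  qed (auto simp: triples_def)
  also have "\<dots> = (\<Sum>c\<le>N. \<Sum>v\<in>triples (N - c). ?G (c, v))"
    by (rule sum_sum_Sigma[symmetric]) auto
  also have "\<dots> = (\<Sum>c\<le>N. ?c c * (qq (2 * (int c)\<^sup>2) * inv_qpoch c * (\<Sum>(k, y)\<in>pairs (N - c). qq (2 * (int k)\<^sup>2 + 4 * int c * int y) * inv_qpoch k * inv_qpoch y)))"
  proof (rule sum.cong[OF refl])
    fix c
    have "(\<Sum>v\<in>triples (N - c). ?G (c, v)) = ?c c * qq (2 * (int c)\<^sup>2) * inv_qpoch c * sum (?C c) (triples (N - c))"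
      by (simp only: prod.case sum_distrib_left)
    moreover have "sum (?C c) (triples (N - c)) = (\<Sum>(k, y)\<in>pairs (N - c). qq (2 * (int k)\<^sup>2 + 4 * int c * int y) * inv_qpoch k * inv_qpoch y)"
      by (rule sum_triples_two_qbin) simp
    ultimately show "(\<Sum>v\<in>triples (N - c). ?G (c, v)) = ?c c * (qq (2 * (int c)\<^sup>2) * inv_qpoch c * (\<Sum>(k, y)\<in>pairs (N - c). qq (2 * (int k)\<^sup>2 + 4 * int c * int y) * inv_qpoch k * inv_qpoch y))"
      by (metis (no_types, lifting) mult.assoc)
  qed
  \<comment> \<open>Read backwards, \<open>sum_pairs_qbin\<close> turns the coefficient of index
    \<open>c\<close> into a sum over \<open>pairs N\<close> with the factor \<open>[A+r; c]\<close>,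
    ready for resummation over \<open>c\<close>.\<close>
  also have "\<dots> = (\<Sum>c\<le>N. ?c c * sum (?R c) (pairs N))"
    by (intro sum.cong refl) (simp only: sum_pairs_qbin atMost_iff)
  also have "\<dots> = (\<Sum>v\<in>pairs N. \<Sum>c\<le>N. ?c c * ?R c v)"
    unfolding sum_distrib_left by (rule sum.swap)
  also have "\<dots> = sum ?r (pairs N)"
  proof (rule sum.cong[OF refl])
    fix v assume "v \<in> pairs N"
    then obtain r A where v: "v = (r, A)" and N: "N = r + 2 * A" by (cases v) auto
    \<comment> \<open>As \<open>N = r + 2 A\<close>, the quotient
      \<open>(q)_(N+a+b) / (q)_(A+a+b)\<close> is \<open>(q)_(A+r)\<close> times this binomial,
      whose \<open>qbin_expand\<close> has the coefficients just found.\<close>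
    have "qbin ((A + a + b) + (A + r)) (A + r) = qpoch (N + a + b) * inv_qpoch (A + r) * inv_qpoch (A + a + b)"
      by (subst qbin_inv_qpoch) (simp_all add: N add_ac mult_2)
    then have "?r v = qq (2 * (int r)\<^sup>2) * inv_qpoch r * inv_qpoch A * (qpoch (A + r) * qbin ((A + a + b) + (A + r)) (A + r))"
      unfolding v prod.case using qpoch_inverse[of "A + r"] by algebra
    also have "\<dots> = (\<Sum>c\<le>A + r. qq (2 * (int r)\<^sup>2) * inv_qpoch r * inv_qpoch A * (qpoch (A + r) * ((- 1) ^ c * qq (4 * (int c * (int (A + a + b) + 1)) + 2 * (int c * (int c - 1))) * inv_qpoch c * inv_qpoch (A + r - c))))"
      unfolding qbin_expand sum_distrib_left ..
    also have "\<dots> = (\<Sum>c\<le>A + r. ?c c * ?R c v)"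
    proof (rule sum.cong[OF refl])
      fix c assume "c \<in> {..A + r}"
      then have c: "c \<le> A + r" by simp
      have e: "qq (2 * (int r)\<^sup>2) * qq (4 * (int c * (int (A + a + b) + 1)) + 2 * (int c * (int c - 1)))
        = qq (4 * int c * int (a + b) + 2 * (int c * (int c + 1))) * qq (2 * (int r)\<^sup>2 + 4 * int c * int A)"
        by (simp add: algebra_simps power2_eq_square flip: qq_add)
      have alg: "x1 * i1 * i2 * (q * (s * x2 * i3 * i4)) = s * x3 * (x4 * (q * i3 * i4) * i1 * i2)"
        if "x1 * x2 = x3 * x4" for s x1 x2 x3 x4 i1 i2 i3 i4 q :: "rat fls"
        using that by algebra
      show "qq (2 * (int r)\<^sup>2) * inv_qpoch r * inv_qpoch A * (qpoch (A + r) * ((- 1) ^ c * qq (4 * (int c * (int (A + a + b) + 1)) + 2 * (int c * (int c - 1))) * inv_qpoch c * inv_qpoch (A + r - c)))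
         = ?c c * ?R c v"
        unfolding v prod.case qbin_inv_qpoch[OF c] by (rule alg[OF e])
    qed
    also have "\<dots> = (\<Sum>c\<le>N. ?c c * ?R c v)"
      by (rule sum.mono_neutral_left) (auto simp: N v dest!: qbin_nzD)
    finally show "(\<Sum>c\<le>N. ?c c * ?R c v) = ?r v" ..
  qed
  finally show ?thesis .
qed

section \<open>Burge products summed to \<open>q\<close>-trinomial coefficients\<close>

lemma T0_eq_sum_pairs:
  "T0 (int (N + w)) (int w) = (\<Sum>(r, A)\<in>pairs N. qq (2 * (int r)\<^sup>2) * qpoch (N + w) * inv_qpoch r * inv_qpoch A * inv_qpoch (A + w))"
proof -
  have "T0 (int (N + w)) (int w) = (\<Sum>r \<in> {r. 0 \<le> r \<and> r \<le> int N \<and> even (int N - r)}.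
        qpow (of_int (r\<^sup>2) / 2) * qpoch (N + w) /
          (qpoch (nat ((int N - r) div 2)) * qpoch (nat ((int N + 2 * int w - r) div 2)) * qpoch (nat r)))"
    unfolding T0_def by (intro sum.cong) (auto simp: algebra_simps nat_int_add)
  also have "\<dots> = (\<Sum>(r, A)\<in>pairs N. qq (2 * (int r)\<^sup>2) * qpoch (N + w) * inv_qpoch r * inv_qpoch A * inv_qpoch (A + w))"
  proof (rule sum.reindex_bij_witness[of _ "\<lambda>(r, A). int r" "\<lambda>r. (nat r, nat ((int N - r) div 2))"])
    fix r assume "r \<in> {r. 0 \<le> r \<and> r \<le> int N \<and> even (int N - r)}"
    then have "0 \<le> r" "r \<le> int N" "2 dvd int N - r" by auto
    moreover from this obtain A where "int N - r = 2 * A" by (meson dvdE)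
    ultimately have r: "0 \<le> r" "int N - r = 2 * A" "0 \<le> A" by auto
    have 1: "(int N + 2 * int w - r) div 2 = A + int w" using r by presburger
    have 2: "qpow (of_int (r\<^sup>2) / 2) = qq (2 * r\<^sup>2)" by (rule qpow_quarter) simp
    show "(case (nat r, nat ((int N - r) div 2)) of (r, A) \<Rightarrow> qq (2 * (int r)\<^sup>2) * qpoch (N + w) * inv_qpoch r * inv_qpoch A * inv_qpoch (A + w))
      = qpow (of_int (r\<^sup>2) / 2) * qpoch (N + w) /
          (qpoch (nat ((int N - r) div 2)) * qpoch (nat ((int N + 2 * int w - r) div 2)) * qpoch (nat r))"
      unfolding 1 2 prod.case using r by (simp add: inv_qpoch_def divide_inverse nat_add_distrib mult_ac)
    show "(nat r, nat ((int N - r) div 2)) \<in> pairs N"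
      using r by simp
  qed auto
  finally show ?thesis .
qed

lemma T0_minus: "T0 L (- a) = T0 L a"
proof -
  have "even (L + a - r) \<longleftrightarrow> even (L - a - r)" for r by presburger
  then show ?thesis unfolding T0_def by (simp add: mult_ac)
qed

text \<open>With \<open>l = a + y\<close>, \<open>i = b + x\<close>, \<open>k = L - i - 2 l\<close>
  the Burge product is \<open>[2a+x+y; x] [2b+x+y; y]\<close> and the index set is
  \<open>triples (L - 2a - b)\<close>; so this is \<open>refined_trinomial_sum\<close> with
  \<open>2 a\<close> in place of \<open>a\<close>.\<close>

lemma T0_burge_nonneg:
  assumes "0 \<le> a" "0 \<le> b"
  shows "(\<Sum>l\<in>{0..L}. \<Sum>i\<in>{0..L}. qq (2 * i\<^sup>2 + 2 * (L - i - 2 * l)\<^sup>2) * qbinom i (L - i - 2 * l) * burge l i a b)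
    = qq (2 * b\<^sup>2) * T0 L (2 * a + b)"
proof -
  let ?f = "\<lambda>(l, i). qq (2 * i\<^sup>2 + 2 * (L - i - 2 * l)\<^sup>2) * qbinom i (L - i - 2 * l) * burge l i a b"
  have nz: "a \<le> l \<and> b \<le> i \<and> i + 2 * l \<le> L" if "?f (l, i) \<noteq> 0" for l i
    using that qbinom_nz[of i "L - i - 2 * l"] burge_nz[of l i a b] assms by auto
  have "(\<Sum>l\<in>{0..L}. \<Sum>i\<in>{0..L}. qq (2 * i\<^sup>2 + 2 * (L - i - 2 * l)\<^sup>2) * qbinom i (L - i - 2 * l) * burge l i a b)
     = sum ?f ({0..L} \<times> {0..L})"
    by (simp add: sum.cartesian_product)
  also have "\<dots> = qq (2 * b\<^sup>2) * T0 L (2 * a + b)"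
  proof (cases "2 * a + b \<le> L")
    case False
    then have "?f v = 0" if "v \<in> {0..L} \<times> {0..L}" for v using nz[of "fst v" "snd v"] by (cases v) fastforce
    then have "sum ?f ({0..L} \<times> {0..L}) = 0" by (rule sum.neutral[rule_format])
    moreover have "T0 L (2 * a + b) = 0" using False assms by (intro T0_eq_0) auto
    ultimately show ?thesis by simp
  next
    case True
    define a' b' N where "a' = nat a" and "b' = nat b" and "N = nat (L - 2 * a - b)"
    have a: "a = int a'" and b: "b = int b'" and L: "L = int (N + (2 * a' + b'))"
      using assms True by (auto simp: a'_def b'_def N_def)
    let ?j = "\<lambda>(l, i). (nat (i - b), nat (L - i - 2 * l), nat (l - a))"
    let ?i = "\<lambda>(x, k, y). (a + int y, b + int x)"
    have "sum ?f ({0..L} \<times> {0..L}) = sum ?f {(l, i). a \<le> l \<and> b \<le> i \<and> i + 2 * l \<le> L}"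
      using assms nz by (intro sum.mono_neutral_right) auto
    also have "\<dots> = (\<Sum>(x, k, y)\<in>triples N. qq (2 * b\<^sup>2) * (qq (2 * (int x)\<^sup>2 + 2 * (int k)\<^sup>2 + 4 * int b' * int x)
      * qbin (b' + x) k * qbin (2 * a' + x + y) x * qbin (2 * b' + x + y) y))"
    proof (rule sum.reindex_bij_witness[of _ ?i ?j])
      fix u assume "u \<in> {(l, i). a \<le> l \<and> b \<le> i \<and> i + 2 * l \<le> L}"
      then obtain l i where u': "u = (l, i)" and *: "a \<le> l" "b \<le> i" "i + 2 * l \<le> L" by auto
      define x y k where "x = nat (i - b)" and "y = nat (l - a)" and "k = nat (L - i - 2 * l)"
      have i: "i = int (b' + x)" and l: "l = int (a' + y)" and k: "L - i - 2 * l = int k"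
        using * by (auto simp: x_def y_def k_def b a)
      have j: "?j u = (x, k, y)" by (simp add: u' x_def y_def k_def)
      have 1: "burge l i a b = qbin (2 * a' + x + y) x * qbin (2 * b' + x + y) y"
        unfolding burge_def i l a b using qbin_sym[of x "2 * a' + x + y"]
        by (simp add: qbin_def algebra_simps)
      have 2: "qbinom i (int k) = qbin (b' + x) k" by (simp add: i qbin_def)
      have e: "qq (2 * i\<^sup>2 + 2 * (int k)\<^sup>2) = qq (2 * b\<^sup>2) * qq (2 * (int x)\<^sup>2 + 2 * (int k)\<^sup>2 + 4 * int b' * int x)"
        unfolding i b by (simp add: algebra_simps power2_eq_square flip: qq_add)
      show "(case ?j u of (x, k, y) \<Rightarrow> qq (2 * b\<^sup>2) * (qq (2 * (int x)\<^sup>2 + 2 * (int k)\<^sup>2 + 4 * int b' * int x)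
        * qbin (b' + x) k * qbin (2 * a' + x + y) x * qbin (2 * b' + x + y) y)) = ?f u"
        unfolding j unfolding u' prod.case k 1 2 e by (simp only: mult.assoc)
    qed (auto simp: triples_def L a b)
    also have "\<dots> = qq (2 * b\<^sup>2) * (\<Sum>(x, k, y)\<in>triples N. qq (2 * (int x)\<^sup>2 + 2 * (int k)\<^sup>2 + 4 * int b' * int x)
      * qbin (b' + x) k * qbin (2 * a' + x + y) x * qbin (2 * b' + x + y) y)"
      by (simp add: sum_distrib_left split_beta)
    also have "\<dots> = qq (2 * b\<^sup>2) * T0 L (2 * a + b)"
    proof -
      have ab: "2 * a + b = int (2 * a' + b')" by (simp add: a b)
      show ?thesis unfolding L ab T0_eq_sum_pairs refined_trinomial_sum by (simp only: add.assoc)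
    qed
    finally show ?thesis .
  qed
  finally show ?thesis .
qed

lemma T0_burge:
  assumes "0 \<le> a \<and> 0 \<le> b \<or> a \<le> 0 \<and> b \<le> 0"
  shows "(\<Sum>l\<in>{0..L}. \<Sum>i\<in>{0..L}. qq (2 * i\<^sup>2 + 2 * (L - i - 2 * l)\<^sup>2) * qbinom i (L - i - 2 * l) * burge l i a b)
    = qq (2 * b\<^sup>2) * T0 L (2 * a + b)"
  using assms
proof
  assume "a \<le> 0 \<and> b \<le> 0"
  then show ?thesis
    using T0_burge_nonneg[of "- a" "- b" L] burge_minus[of _ _ a b] T0_minus[of L "2 * a + b"]
    by simp
qed (use T0_burge_nonneg in blast)

subsection \<open>Bosonic sums and the Euclidean algorithm\<close>

definition boson_summand :: "int \<Rightarrow> int \<Rightarrow> int \<Rightarrow> int \<Rightarrow> int \<Rightarrow> int \<Rightarrow> int \<Rightarrow> rat fls" where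
  "boson_summand K P u v L M j = qq (4 * (j * (K * P * j + 1))) * burge L M (K * j) (P * j)
     - qq (4 * ((K * j + u) * (P * j + v))) * burge L M (K * j + u) (P * j + v)"

text \<open>For admissible parameters the cutoff catches all nonzero summands, and a larger one
  gives the same value (\<open>boson_eq_sum\<close>); this brings sums for different
  \<open>L\<close> to a common range.\<close>

definition boson :: "int \<Rightarrow> int \<Rightarrow> int \<Rightarrow> int \<Rightarrow> int \<Rightarrow> int \<Rightarrow> rat fls" where
  "boson K P u v L M = (\<Sum>j\<in>{- (\<bar>L\<bar> + 1)..\<bar>L\<bar> + 1}. boson_summand K P u v L M j)"

text \<open>The ranges of \<open>u\<close> and \<open>v\<close> put \<open>K j + u\<close> and
  \<open>P j + v\<close> on the same side of 0 for every \<open>j\<close>; the determinant is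
  invariant up to sign under the Euclidean steps.\<close>

definition admissible :: "int \<Rightarrow> int \<Rightarrow> int \<Rightarrow> int \<Rightarrow> bool" where
  "admissible K P u v \<longleftrightarrow> 1 \<le> K \<and> 1 \<le> P \<and> 0 \<le> u \<and> u \<le> K \<and> 0 \<le> v \<and> v \<le> P \<and> \<bar>K * v - P * u\<bar> = 1"

lemma admissible_swap: "admissible K P u v \<Longrightarrow> admissible P K v u"
  unfolding admissible_def by auto

lemma abs_le_of_affine:
  fixes K u L j :: int
  assumes "1 \<le> K" "0 \<le> u" "u \<le> K" "\<bar>K * j\<bar> \<le> L \<or> \<bar>K * j + u\<bar> \<le> L"
  shows "\<bar>j\<bar> \<le> \<bar>L\<bar> + 1"
proof (cases "0 \<le> j")
  case True
  then have "j \<le> K * j" using assms(1) mult_right_mono[of 1 K j] by simp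
  then show ?thesis using True assms by linarith
next
  case False
  then have "K * (j + 1) \<le> j + 1" using assms(1) mult_right_mono_neg[of 1 K "j + 1"] by simp
  then have "K * j + K \<le> j + 1" by (simp add: algebra_simps)
  then show ?thesis using False assms by linarith
qed

lemma boson_eq_sum:
  assumes "admissible K P u v" "\<bar>L\<bar> + 1 \<le> R"
  shows "boson K P u v L M = (\<Sum>j\<in>{-R..R}. boson_summand K P u v L M j)"
  unfolding boson_def
proof (rule sum.mono_neutral_left)
  show "\<forall>j\<in>{-R..R} - {- (\<bar>L\<bar> + 1)..\<bar>L\<bar> + 1}. boson_summand K P u v L M j = 0"
  proof
    fix j assume j: "j \<in> {-R..R} - {- (\<bar>L\<bar> + 1)..\<bar>L\<bar> + 1}"
    show "boson_summand K P u v L M j = 0"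
    proof (rule ccontr)
      assume "boson_summand K P u v L M j \<noteq> 0"
      then have "burge L M (K * j) (P * j) \<noteq> 0 \<or> burge L M (K * j + u) (P * j + v) \<noteq> 0"
        unfolding boson_summand_def by auto
      then have "\<bar>K * j\<bar> \<le> L \<or> \<bar>K * j + u\<bar> \<le> L" using burge_nz by blast
      then show False using abs_le_of_affine[of K u j L] assms(1) j unfolding admissible_def by auto
    qed
  qed
qed (use assms(2) in auto)

lemma boson_swap:
  assumes "admissible K P u v"
  shows "boson K P u v L M = boson P K v u M L"
proof -
  let ?R = "\<bar>L\<bar> + \<bar>M\<bar> + 1"
  have "boson_summand K P u v L M j = boson_summand P K v u M L j" for j
    unfolding boson_summand_def burge_swap[of L M] by (simp add: mult_ac)
  then show ?thesis
    using boson_eq_sum[OF assms, of L ?R M] boson_eq_sum[OF admissible_swap[OF assms], of M ?R L] by simp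
qed

text \<open>\<open>burge_transform\<close> applied for each \<open>j\<close>; its factor
  \<open>q^(b^2)\<close> changes the product \<open>K P\<close> in the exponent to
  \<open>(K + P) P\<close>.\<close>

lemma boson_transform:
  assumes "admissible K P u v"
  shows "(\<Sum>i\<in>{0..L}. qq (4 * i\<^sup>2) * qbinom (2 * L + M - i) (2 * L) * boson K P u v (L - i) i)
    = boson (K + P) P (u + v) v L M"
proof -
  let ?J = "{- (\<bar>L\<bar> + 1)..\<bar>L\<bar> + 1}"
  let ?w = "\<lambda>i. qq (4 * i\<^sup>2) * qbinom (2 * L + M - i) (2 * L)"
  have KP: "0 \<le> K" "0 \<le> P" "0 \<le> u" "u \<le> K" "0 \<le> v" "v \<le> P" using assms by (auto simp: admissible_def)
  have term_eq: "(\<Sum>i\<in>{0..L}. ?w i * boson_summand K P u v (L - i) i j) = boson_summand (K + P) P (u + v) v L M j" for j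
  proof -
    have s1: "0 \<le> K * j \<and> 0 \<le> P * j \<or> K * j \<le> 0 \<and> P * j \<le> 0"
      using KP by (cases "0 \<le> j") (auto simp: mult_nonneg_nonpos)
    have s2: "0 \<le> K * j + u \<and> 0 \<le> P * j + v \<or> K * j + u \<le> 0 \<and> P * j + v \<le> 0"
    proof (cases "0 \<le> j")
      case False
      \<comment> \<open>For \<open>j < 0\<close> the bound \<open>u \<le> K\<close> gives
        \<open>K j + u \<le> K (j + 1) \<le> 0\<close>, and \<open>v \<le> P\<close> does the same
        for \<open>P\<close>.\<close>
      then have "K * (j + 1) \<le> 0" "P * (j + 1) \<le> 0" using KP by (auto intro: mult_nonneg_nonpos)
      then show ?thesis using KP by (auto simp: algebra_simps)
    qed (use KP in auto)
    have e1: "qq (4 * (j * (K * P * j + 1))) * qq (4 * (P * j)\<^sup>2) = qq (4 * (j * ((K + P) * P * j + 1)))"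
      by (simp add: algebra_simps power2_eq_square flip: qq_add)
    have e2: "qq (4 * ((K * j + u) * (P * j + v))) * qq (4 * (P * j + v)\<^sup>2) = qq (4 * (((K + P) * j + (u + v)) * (P * j + v)))"
      by (simp add: algebra_simps power2_eq_square flip: qq_add)
    have "(\<Sum>i\<in>{0..L}. ?w i * boson_summand K P u v (L - i) i j)
      = qq (4 * (j * (K * P * j + 1))) * (\<Sum>i\<in>{0..L}. ?w i * burge (L - i) i (K * j) (P * j))
        - qq (4 * ((K * j + u) * (P * j + v))) * (\<Sum>i\<in>{0..L}. ?w i * burge (L - i) i (K * j + u) (P * j + v))"
      unfolding boson_summand_def right_diff_distrib sum_subtractf sum_distrib_left by (simp only: mult_ac)
    also have "\<dots> = boson_summand (K + P) P (u + v) v L M j"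
      unfolding burge_transform[OF s1] burge_transform[OF s2] boson_summand_def e1[symmetric] e2[symmetric]
      by (simp add: algebra_simps)
    finally show ?thesis .
  qed
  have "(\<Sum>i\<in>{0..L}. ?w i * boson K P u v (L - i) i) = (\<Sum>i\<in>{0..L}. \<Sum>j\<in>?J. ?w i * boson_summand K P u v (L - i) i j)"
    using boson_eq_sum[OF assms, of _ "\<bar>L\<bar> + 1"] by (intro sum.cong refl) (simp add: sum_distrib_left)
  also have "\<dots> = (\<Sum>j\<in>?J. boson_summand (K + P) P (u + v) v L M j)"
    by (subst sum.swap) (simp only: term_eq)
  finally show ?thesis by (simp only: boson_def)
qed

lemma sum_int_telescope:
  fixes f :: "int \<Rightarrow> 'a::ab_group_add"
  assumes "a \<le> b + 1"
  shows "(\<Sum>j\<in>{a..b}. f j - f (j + 1)) = f a - f (b + 1)"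
proof -
  have "(\<Sum>j\<in>{a..<a + int n}. f j - f (j + 1)) = f a - f (a + int n)" for n
  proof (induction n)
    case (Suc n)
    have "{a..<a + int (Suc n)} = insert (a + int n) {a..<a + int n}" by auto
    then show ?case using Suc by (simp add: algebra_simps)
  qed simp
  from this[of "nat (b + 1 - a)"] have "(\<Sum>j\<in>{a..<b + 1}. f j - f (j + 1)) = f a - f (b + 1)"
    using assms by simp
  moreover have "{a..<b + 1} = {a..b}" by auto
  ultimately show ?thesis by simp
qed

text \<open>\<open>0 \<le> n\<close> excludes \<open>n = k = -1\<close>, where the rule fails
  because \<open>[0; 0] = 1\<close>. That failure is what leaves the value 1 at
  \<open>L = M = 0\<close> in \<open>boson_1_1\<close>.\<close>

lemma qbinom_Pascal:
  assumes "0 \<le> n"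
  shows "qbinom (n + 1) (k + 1) = qbinom n k + qq (4 * (k + 1)) * qbinom n (k + 1)"
proof -
  consider "0 \<le> k" | "k = - 1" | "k < - 1" by linarith
  then show ?thesis
  proof cases
    case 1
    then show ?thesis using qbin_Suc[of "nat n" "nat k"] assms by (simp add: qbin_def algebra_simps)
  next
    case 2
    then show ?thesis using assms by (simp add: qbinom_def)
  qed (simp add: qbinom_def)
qed

lemma boson_1_1: "boson 1 1 1 0 L M = (if L = 0 \<and> M = 0 then 1 else 0)"
proof -
  consider "L < 0 \<or> M < 0" | "L = 0 \<and> M = 0" | "0 \<le> L" "0 \<le> M" "1 \<le> L + M" by linarith
  then show ?thesis
  proof cases
    case 1
    then have "burge L M a b = 0" for a b using burge_nz[of L M a b] by force
    then have "boson_summand 1 1 1 0 L M j = 0" for j by (simp add: boson_summand_def)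
    then show ?thesis using 1 by (auto simp: boson_def)
  next
    case 2
    have "{-1..1} = {-1, 0, 1 :: int}" by auto
    then show ?thesis using 2 by (simp add: boson_def boson_summand_def burge_def qbinom_def)
  next
    case 3
    \<comment> \<open>Origin of \<open>f\<close>: split \<open>[L+M; L-j]\<close> in the positive
      product and \<open>[L+M+1; L+j+1]\<close> in the negative one by \<open>q\<close>-Pascal. The
      two products \<open>[L+M; L+j] [L+M-1; L-j-1]\<close> cancel, and the others are consecutive
      values of \<open>f\<close>.\<close>
    define f where "f j = qq (4 * (L + j\<^sup>2)) * (qbinom (L + M) (L + j) * qbinom (L + M - 1) (L - j))" for j
    have step: "boson_summand 1 1 1 0 L M j = f j - f (j + 1)" for j
    proof -
      have 1: "qbinom (L + M) (L - j) = qbinom (L + M - 1) (L - j - 1) + qq (4 * (L - j)) * qbinom (L + M - 1) (L - j)"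
        using qbinom_Pascal[of "L + M - 1" "L - j - 1"] 3 by simp
      have 2: "qbinom (L + M + 1) (L + j + 1) = qbinom (L + M) (L + j) + qq (4 * (L + j + 1)) * qbinom (L + M) (L + j + 1)"
        using qbinom_Pascal[of "L + M" "L + j"] 3 by simp
      have e1: "qq (4 * (j * (j + 1))) * qq (4 * (L - j)) = qq (4 * (L + j\<^sup>2))"
        by (simp add: algebra_simps power2_eq_square flip: qq_add)
      have e2: "qq (4 * (j * (j + 1))) * qq (4 * (L + j + 1)) = qq (4 * (L + (j + 1)\<^sup>2))"
        by (simp add: algebra_simps power2_eq_square flip: qq_add)
      have b: "burge L M j j = qbinom (L + M) (L + j) * qbinom (L + M) (L - j)"
        "burge L M (j + 1) j = qbinom (L + M + 1) (L + j + 1) * qbinom (L + M - 1) (L - j - 1)"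
        by (simp_all add: burge_def algebra_simps)
      have alg: "x * (a * (c + y * d)) - x * ((a + z * e) * c) = (x * y) * (a * d) - (x * z) * (e * c)" for x a c y d z e :: "rat fls"
        by (simp add: algebra_simps)
      have "boson_summand 1 1 1 0 L M j = qq (4 * (j * (j + 1))) * burge L M j j - qq (4 * (j * (j + 1))) * burge L M (j + 1) j"
        by (simp add: boson_summand_def algebra_simps)
      also have "\<dots> = qq (4 * (L + j\<^sup>2)) * (qbinom (L + M) (L + j) * qbinom (L + M - 1) (L - j))
          - qq (4 * (L + (j + 1)\<^sup>2)) * (qbinom (L + M) (L + j + 1) * qbinom (L + M - 1) (L - j - 1))"
        unfolding b 1 2 alg e1 e2 ..
      also have "\<dots> = f j - f (j + 1)"
        by (simp add: f_def algebra_simps)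
      finally show ?thesis .
    qed
    have "boson 1 1 1 0 L M = f (- (\<bar>L\<bar> + 1)) - f (\<bar>L\<bar> + 1 + 1)"
      unfolding boson_def step by (rule sum_int_telescope) simp
    \<comment> \<open>At the two ends a lower entry is \<open>-1\<close> and \<open>-2\<close>
      respectively.\<close>
    also have "\<dots> = 0" using 3 by (simp add: f_def qbinom_def)
    finally show ?thesis using 3 by auto
  qed
qed

text \<open>
  The list records the rows \<open>2, \<dots>, d\<close> of the matrix, \<open>True\<close> marking the rows \<open>t_m\<close>; the base case is the
  bosonic sum for \<open>(K, P) = (2, 1)\<close>.
\<close>

fun chain_fermion :: "bool list \<Rightarrow> int \<Rightarrow> int \<Rightarrow> rat fls" where
  "chain_fermion [] L M = (if L = 0 \<and> 0 \<le> M then 1 else 0)"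
| "chain_fermion (t # ts) L M = (\<Sum>i\<in>{0..L}. qq (4 * i\<^sup>2) * qbinom (2 * L + M - i) (2 * L) *
     (if t then chain_fermion ts i (L - i) else chain_fermion ts (L - i) i))"

fun chain_params :: "bool list \<Rightarrow> int \<times> int" where
  "chain_params [] = (2, 1)"
| "chain_params (t # ts) = (let (K, P) = chain_params ts in (K + P, if t then K else P))"

lemma chain_params_pos: "1 \<le> fst (chain_params ts) \<and> 1 \<le> snd (chain_params ts)"
  by (induction ts) (auto simp: Let_def split_beta)

text \<open>One transform of the delta function \<open>boson_1_1\<close>: only
  \<open>L = i = 0\<close> survives, with coefficient \<open>[M; 0]\<close>. The determinant forces
  \<open>u = 1\<close>, and \<open>v = 0\<close>, \<open>v = 1\<close> stem from the solutions
  \<open>(1, 0)\<close>, \<open>(0, 1)\<close> for the pair \<open>(1, 1)\<close>.\<close>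

lemma boson_2_1:
  assumes "admissible 2 1 u v"
  shows "boson 2 1 u v L M = (if L = 0 \<and> 0 \<le> M then 1 else 0)"
proof -
  have "(\<Sum>i\<in>{0..L}. qq (4 * i\<^sup>2) * qbinom (2 * L + M - i) (2 * L) * (if L - i = 0 \<and> i = 0 then 1 else 0))
     = (if L = 0 \<and> 0 \<le> M then 1 else 0)"
  proof (cases "L = 0")
    case False
    then show ?thesis by (auto intro!: sum.neutral)
  qed (simp add: qbinom_def)
  moreover have "boson 1 1 0 1 L M = (if L = 0 \<and> M = 0 then 1 else 0)" for L M
    using boson_swap[of 1 1 0 1 L M] boson_1_1[of M L] by (auto simp: admissible_def)
  moreover have v: "v = 0 \<or> v = 1" using assms unfolding admissible_def by auto
  moreover have "u = 1" using assms v unfolding admissible_def by auto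
  moreover have "admissible 1 1 1 0" "admissible 1 1 0 1" by (simp_all add: admissible_def)
  ultimately show ?thesis
    using boson_transform[of 1 1 1 0 L M] boson_transform[of 1 1 0 1 L M] by (auto simp: boson_1_1)
qed

text \<open>If \<open>u \<le> -1\<close>, the determinant gives
  \<open>K v \<le> 1 - P \<le> 0\<close>, against \<open>0 \<le> u + v\<close>; the case
  \<open>u \<ge> K + 1\<close> is the mirror image. It serves to undo a Euclidean step and also to
  place the initial \<open>u\<close> and \<open>v\<close>.\<close>

lemma admissible_bounds:
  fixes K P u v :: int
  assumes "1 \<le> K" "1 \<le> P" "\<bar>K * v - P * u\<bar> = 1" "0 \<le> u + v" "u + v \<le> K + P"
    and "0 \<le> v \<and> v \<le> P \<or> 0 < u + v \<and> u + v < K + P"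
  shows "0 \<le> u \<and> u \<le> K"
proof (rule ccontr)
  assume "\<not> (0 \<le> u \<and> u \<le> K)"
  then consider "u \<le> - 1" | "K + 1 \<le> u" by linarith
  then show False
  proof cases
    case 1
    then have "P * u \<le> - P" using assms(2) mult_left_mono[of u "- 1" P] by simp
    then have "K * v \<le> 0" using assms(2,3) by linarith
    then have "v \<le> 0" using assms(1) by (simp add: mult_le_0_iff)
    then show False using 1 assms(4) by linarith
  next
    case 2
    then have "P * (K + 1) \<le> P * u" using assms(2) mult_left_mono[of "K + 1" u P] by simp
    then have "K * P \<le> K * v" using assms(2,3) by (simp add: algebra_simps)
    then have "P \<le> v" using assms(1) by simp
    then show False using 2 assms(5) by linarith
  qed
qed

text \<open>In both cases the transform acts on parameters \<open>(u - v, v)\<close>. For a turn it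
  acts on the swapped pair \<open>(P', K')\<close>, so the induction hypothesis is needed at
  \<open>(v, u - v)\<close>; hence \<open>u\<close> and \<open>v\<close> are arbitrary in the
  induction.\<close>

lemma chain_fermion_eq_boson:
  assumes "chain_params ts = (K, P)" "admissible K P u v"
  shows "chain_fermion ts L M = boson K P u v L M"
  using assms
proof (induction ts arbitrary: K P u v L M)
  case Nil
  then show ?case using boson_2_1 by simp
next
  case (Cons t ts)
  obtain K' P' where chain_params: "chain_params ts = (K', P')" by (cases "chain_params ts")
  have pos: "1 \<le> K' \<and> 1 \<le> P'" using chain_params_pos[of ts] chain_params by simp
  show ?case
  proof (cases t)
    case True
    then have KP: "K = K' + P'" "P = K'" using Cons.prems(1) chain_params by auto
    have "admissible K' P' v (u - v)"
      using Cons.prems(2) pos admissible_bounds[of P' K' v "u - v"] unfolding KP admissible_def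
      by (auto simp: algebra_simps)
    then have *: "admissible K' P' v (u - v)" and **: "admissible P' K' (u - v) v" by (auto intro: admissible_swap)
    have "chain_fermion ts i (L - i) = boson P' K' (u - v) v (L - i) i" for i
      using Cons.IH[OF chain_params *] boson_swap[OF *] by simp
    then show ?thesis using boson_transform[OF **, of L M] True by (simp add: KP add.commute)
  next
    case False
    then have KP: "K = K' + P'" "P = P'" using Cons.prems(1) chain_params by auto
    have *: "admissible K' P' (u - v) v"
      using Cons.prems(2) pos admissible_bounds[of K' P' v "u - v"] unfolding KP admissible_def
      by (auto simp: algebra_simps)
    show ?thesis using boson_transform[OF *, of L M] Cons.IH[OF chain_params *] False by (simp add: KP)
  qed
qed

lemma sum_T0_boson:
  assumes admissible: "admissible (p' - p) (2 * p - p') (s - r) (2 * r - s)"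
  shows "(\<Sum>l\<in>{0..L}. \<Sum>i\<in>{0..L}. qq (2 * i\<^sup>2 + 2 * (L - i - 2 * l)\<^sup>2) * qbinom i (L - i - 2 * l)
      * boson (p' - p) (2 * p - p') (s - r) (2 * r - s) l i)
    = Sum_any (\<lambda>j::int. bosonic_term p p' r s L j)"
proof -
  define K P u v where "K = p' - p" and "P = 2 * p - p'" and "u = s - r" and "v = 2 * r - s"
  let ?J = "{- (\<bar>L\<bar> + 1)..\<bar>L\<bar> + 1}"
  let ?w = "\<lambda>l i. qq (2 * i\<^sup>2 + 2 * (L - i - 2 * l)\<^sup>2) * qbinom i (L - i - 2 * l)"
  have admissible: "admissible K P u v" using admissible by (simp add: K_def P_def u_def v_def)
  have KP: "0 \<le> K" "0 \<le> P" "0 \<le> u" "u \<le> K" "0 \<le> v" "v \<le> P" "1 \<le> K" using admissible by (auto simp: admissible_def)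
  have p': "p' = 2 * K + P" and s: "s = 2 * u + v" by (simp_all add: K_def P_def u_def v_def)
  have term_eq: "(\<Sum>l\<in>{0..L}. \<Sum>i\<in>{0..L}. ?w l i * boson_summand K P u v l i j) = bosonic_term p p' r s L j" for j
  proof -
    have s1: "0 \<le> K * j \<and> 0 \<le> P * j \<or> K * j \<le> 0 \<and> P * j \<le> 0"
      using KP by (cases "0 \<le> j") (auto simp: mult_nonneg_nonpos)
    have s2: "0 \<le> K * j + u \<and> 0 \<le> P * j + v \<or> K * j + u \<le> 0 \<and> P * j + v \<le> 0"
    proof (cases "0 \<le> j")
      case False
      then have "K * (j + 1) \<le> 0" "P * (j + 1) \<le> 0" using KP by (auto intro: mult_nonneg_nonpos)
      then show ?thesis using KP by (auto simp: algebra_simps)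
    qed (use KP in auto)
    have q1: "qpow (of_int (j * (p' * (2 * p - p') * j + 2)) / 2) = qq (4 * (j * (K * P * j + 1))) * qq (2 * (P * j)\<^sup>2)"
    proof -
      have "qpow (of_int (j * (p' * (2 * p - p') * j + 2)) / 2) = qq (2 * (j * (p' * P * j + 2)))"
        by (rule qpow_quarter) (simp add: P_def)
      also have "\<dots> = qq (4 * (j * (K * P * j + 1))) * qq (2 * (P * j)\<^sup>2)"
        by (simp add: p' algebra_simps power2_eq_square flip: qq_add)
      finally show ?thesis .
    qed
    have q2: "qpow (of_int (((2 * p - p') * j + 2 * r - s) * (p' * j + s)) / 2)
      = qq (4 * ((K * j + u) * (P * j + v))) * qq (2 * (P * j + v)\<^sup>2)"
    proof -
      have *: "(2 * p - p') * j + 2 * r - s = P * j + v" by (simp add: P_def v_def)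
      have "qpow (of_int (((2 * p - p') * j + 2 * r - s) * (p' * j + s)) / 2) = qq (2 * ((P * j + v) * (p' * j + s)))"
        unfolding * by (rule qpow_quarter) simp
      also have "\<dots> = qq (4 * ((K * j + u) * (P * j + v))) * qq (2 * (P * j + v)\<^sup>2)"
        by (simp add: p' s algebra_simps power2_eq_square flip: qq_add)
      finally show ?thesis .
    qed
    have a: "2 * (K * j) + P * j = p' * j" "2 * (K * j + u) + (P * j + v) = p' * j + s"
      by (simp_all add: p' s algebra_simps)
    have "(\<Sum>l\<in>{0..L}. \<Sum>i\<in>{0..L}. ?w l i * boson_summand K P u v l i j)
      = qq (4 * (j * (K * P * j + 1))) * (\<Sum>l\<in>{0..L}. \<Sum>i\<in>{0..L}. ?w l i * burge l i (K * j) (P * j))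
        - qq (4 * ((K * j + u) * (P * j + v))) * (\<Sum>l\<in>{0..L}. \<Sum>i\<in>{0..L}. ?w l i * burge l i (K * j + u) (P * j + v))"
      unfolding boson_summand_def right_diff_distrib sum_subtractf sum_distrib_left by (simp only: mult_ac)
    also have "\<dots> = bosonic_term p p' r s L j"
      unfolding T0_burge[OF s1] T0_burge[OF s2] bosonic_term_def q1 q2 a by (simp only: mult.assoc)
    finally show ?thesis .
  qed
  have "(\<Sum>l\<in>{0..L}. \<Sum>i\<in>{0..L}. ?w l i * boson K P u v l i) = (\<Sum>l\<in>{0..L}. \<Sum>i\<in>{0..L}. \<Sum>j\<in>?J. ?w l i * boson_summand K P u v l i j)"
    using boson_eq_sum[OF admissible, of _ "\<bar>L\<bar> + 1"] by (intro sum.cong refl) (simp add: sum_distrib_left)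
  also have "\<dots> = (\<Sum>j\<in>?J. \<Sum>l\<in>{0..L}. \<Sum>i\<in>{0..L}. ?w l i * boson_summand K P u v l i j)"
    by (subst sum.swap, subst (2) sum.swap) (rule refl)
  also have "\<dots> = (\<Sum>j\<in>?J. bosonic_term p p' r s L j)"
    by (simp only: term_eq)
  also have "\<dots> = Sum_any (\<lambda>j::int. bosonic_term p p' r s L j)"
  proof (rule Sum_any.expand_superset[symmetric])
    show "{j. bosonic_term p p' r s L j \<noteq> 0} \<subseteq> ?J"
    proof
      fix j assume "j \<in> {j. bosonic_term p p' r s L j \<noteq> 0}"
      then have "T0 L (p' * j) \<noteq> 0 \<or> T0 L (p' * j + s) \<noteq> 0" by (auto simp: bosonic_term_def)
      then have "\<bar>p' * j\<bar> \<le> L \<or> \<bar>p' * j + s\<bar> \<le> L" using T0_eq_0 not_le by blast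
      then have "\<bar>j\<bar> \<le> \<bar>L\<bar> + 1" by (rule abs_le_of_affine[rotated 3]) (use KP p' s in auto)
      then show "j \<in> ?J" by auto
    qed
  qed simp
  finally show ?thesis by (simp only: K_def P_def u_def v_def)
qed

subsection \<open>The fermionic side\<close>

text \<open>All \<open>m\<close> up to \<open>n\<close> count, even if \<open>\<nu> n = 0\<close>:
  row \<open>d = t_n\<close> then yields \<open>m (d - 1) + m d\<close>, which is a turn with
  \<open>m (d + 1) = 0\<close>. If \<open>\<nu> n \<noteq> 0\<close>, row \<open>d\<close> is an
  ordinary row with \<open>m (d + 1) = 0\<close>. \<open>Imul_turn\<close> records this uniform
  description.\<close>

definition turn :: "nat \<Rightarrow> (nat \<Rightarrow> nat) \<Rightarrow> nat \<Rightarrow> bool" where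
  "turn n \<nu> j \<longleftrightarrow> (\<exists>m\<in>{1..n}. j = tpos \<nu> m)"

section \<open>The continued fraction and the pattern of turns\<close>

lemma tpos_mono: "a \<le> b \<Longrightarrow> tpos \<nu> a \<le> tpos \<nu> b"
  unfolding tpos_def by (rule sum_mono2) auto

lemma tpos_Suc: "tpos \<nu> (Suc m) = tpos \<nu> m + \<nu> m"
  by (simp add: tpos_def)

lemma cf_dim_tpos: "cf_dim n \<nu> = tpos \<nu> n + \<nu> n"
  by (simp add: cf_dim_def tpos_def lessThan_Suc_atMost[symmetric])

lemma chain_params_replicate: "chain_params ts = (K, P) \<Longrightarrow> chain_params (replicate a False @ ts) = (K + int a * P, P)"
  by (induction a) (auto simp: algebra_simps)

text \<open>Downward induction on \<open>m\<close>: the rows behind \<open>t_m\<close> encode the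
  tail \<open>[\<nu> m, ..., \<nu> n + 2]\<close>. The base pair \<open>(2, 1)\<close> accounts for
  the \<open>+ 2\<close>; for \<open>m < n\<close>, a block of \<open>\<nu> m - 1\<close> ordinary
  rows and a turn sends \<open>(K', P')\<close> to \<open>(P' + \<nu> m * K', K')\<close>.
  Coprimality is carried along because only then does the quotient determine the pair.\<close>

lemma chain_params_row_types:
  assumes "m \<le> n" "1 \<le> m" "\<forall>i<n. 1 \<le> \<nu> i"
    and "chain_params (map (turn n \<nu>) [Suc (tpos \<nu> m)..<Suc (cf_dim n \<nu>)]) = (K, P)"
  shows "coprime K P \<and> of_int K / of_int P = cfrac_eval (map \<nu> [m..<n] @ [\<nu> n + 2])"
  using assms
proof (induction arbitrary: K P rule: inc_induct)
  case base
  have "\<not> turn n \<nu> j" if "tpos \<nu> n < j" for j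
    using that tpos_mono[of _ n \<nu>] unfolding turn_def by fastforce
  then have "map (turn n \<nu>) [Suc (tpos \<nu> n)..<Suc (cf_dim n \<nu>)] = replicate (\<nu> n) False"
    by (intro nth_equalityI) (auto simp: cf_dim_tpos simp del: upt_Suc)
  then have "(K, P) = (2 + int (\<nu> n), 1)"
    using base chain_params_replicate[of "[]" 2 1 "\<nu> n"] by simp
  then show ?case by simp
next
  case (step m)
  have nu: "1 \<le> \<nu> m" using step by simp
  let ?ts = "map (turn n \<nu>) [Suc (tpos \<nu> (Suc m))..<Suc (cf_dim n \<nu>)]"
  have "[Suc (tpos \<nu> m)..<Suc (cf_dim n \<nu>)] = [Suc (tpos \<nu> m)..<tpos \<nu> (Suc m)] @ [tpos \<nu> (Suc m)..<Suc (cf_dim n \<nu>)]"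
  proof -
    have "tpos \<nu> (Suc m) \<le> tpos \<nu> n" using step by (intro tpos_mono) auto
    then have "Suc (tpos \<nu> m) \<le> tpos \<nu> (Suc m)" "tpos \<nu> (Suc m) \<le> Suc (cf_dim n \<nu>)"
      using nu by (simp_all add: tpos_Suc cf_dim_tpos)
    then show ?thesis
      by (metis le_add_diff_inverse upt_add_eq_append)
  qed
  also have "[tpos \<nu> (Suc m)..<Suc (cf_dim n \<nu>)] = tpos \<nu> (Suc m) # [Suc (tpos \<nu> (Suc m))..<Suc (cf_dim n \<nu>)]"
  proof (rule upt_conv_Cons)
    have "tpos \<nu> (Suc m) \<le> tpos \<nu> n" using step by (intro tpos_mono) auto
    then show "tpos \<nu> (Suc m) < Suc (cf_dim n \<nu>)" by (simp add: cf_dim_tpos)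
  qed
  finally have split: "map (turn n \<nu>) [Suc (tpos \<nu> m)..<Suc (cf_dim n \<nu>)]
    = map (turn n \<nu>) [Suc (tpos \<nu> m)..<tpos \<nu> (Suc m)] @ turn n \<nu> (tpos \<nu> (Suc m)) # ?ts"
    by simp
  have "turn n \<nu> (tpos \<nu> (Suc m))" using step unfolding turn_def by force
  moreover have "map (turn n \<nu>) [Suc (tpos \<nu> m)..<tpos \<nu> (Suc m)] = replicate (\<nu> m - 1) False"
  proof -
    have "\<not> turn n \<nu> j" if "tpos \<nu> m < j" "j < tpos \<nu> (Suc m)" for j
    proof
      assume "turn n \<nu> j"
      then obtain m' where "j = tpos \<nu> m'" unfolding turn_def by auto
      then show False
        using that tpos_mono[of m' m \<nu>] tpos_mono[of "Suc m" m' \<nu>] by (cases "m' \<le> m") auto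
    qed
    then show ?thesis by (intro nth_equalityI) (auto simp: tpos_Suc)
  qed
  ultimately have ts: "map (turn n \<nu>) [Suc (tpos \<nu> m)..<Suc (cf_dim n \<nu>)] = replicate (\<nu> m - 1) False @ True # ?ts"
    using split by simp
  obtain K' P' where chain_params: "chain_params ?ts = (K', P')" by (cases "chain_params ?ts")
  have IH: "coprime K' P'" "of_int K' / of_int P' = cfrac_eval (map \<nu> [Suc m..<n] @ [\<nu> n + 2])"
    using step chain_params by auto
  have pos: "1 \<le> K'" "1 \<le> P'" using chain_params_pos[of ?ts] chain_params by auto
  have "chain_params (True # ?ts) = (K' + P', K')" using chain_params by simp
  then have "chain_params (map (turn n \<nu>) [Suc (tpos \<nu> m)..<Suc (cf_dim n \<nu>)]) = (K' + P' + int (\<nu> m - 1) * K', K')"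
    unfolding ts by (rule chain_params_replicate)
  then have KP: "K = P' + int (\<nu> m) * K'" "P = K'"
    using step.prems nu by (auto simp: algebra_simps of_nat_diff)
  have 1: "coprime K P"
    using IH(1) gcd_add_mult[of K' "int (\<nu> m)" P'] unfolding KP
    by (simp add: coprime_iff_gcd_eq_1 gcd.commute[of _ K'] add.commute)
  obtain b bs where bs: "map \<nu> [Suc m..<n] @ [\<nu> n + 2] = b # bs"
    by (cases "map \<nu> [Suc m..<n] @ [\<nu> n + 2]") auto
  have "map \<nu> [m..<n] @ [\<nu> n + 2] = \<nu> m # b # bs"
    using bs step by (simp add: upt_conv_Cons)
  then have "cfrac_eval (map \<nu> [m..<n] @ [\<nu> n + 2]) = of_nat (\<nu> m) + 1 / (of_int K' / of_int P')"
    using IH(2) bs by simp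
  also have "\<dots> = of_int K / of_int P"
    using pos by (simp add: KP field_simps)
  finally show ?case using 1 by simp
qed

text \<open>Since \<open>\<nu> 0 = 1\<close>, \<open>p / (p' - p) = 1 + P / K\<close>; so
  \<open>(K, P)\<close> and \<open>(p' - p, 2 p - p')\<close> are positive coprime pairs with the
  same quotient.\<close>

lemma chain_params_cfrac:
  assumes "1 < p" "3 * p < 2 * p'" "p' < 2 * p" "coprime p p'"
    and cf: "cfrac_expansion (of_int p / of_int (p' - p)) n \<nu>"
    and n: "1 \<le> n" and nu0: "\<nu> 0 = 1"
  shows "chain_params (map (turn n \<nu>) [2..<Suc (cf_dim n \<nu>)]) = (p' - p, 2 * p - p')"
proof -
  have pos: "\<forall>i<n. 1 \<le> \<nu> i" and x: "of_int p / of_int (p' - p) = cfrac_eval (map \<nu> [0..<n] @ [\<nu> n + 2])"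
    using cf by (auto simp: cfrac_expansion_def)
  have t1: "tpos \<nu> 1 = 1" by (simp add: tpos_def nu0)
  obtain K P where chain_params: "chain_params (map (turn n \<nu>) [2..<Suc (cf_dim n \<nu>)]) = (K, P)" by fastforce
  have KP: "coprime K P" "of_int K / of_int P = cfrac_eval (map \<nu> [1..<n] @ [\<nu> n + 2])"
    using chain_params_row_types[OF n order_refl pos, of K P] chain_params unfolding t1 Suc_1 by blast+
  have KP0: "1 \<le> K" "1 \<le> P" using chain_params_pos[of "map (turn n \<nu>) [2..<Suc (cf_dim n \<nu>)]"] chain_params by auto
  obtain b bs where bs: "map \<nu> [1..<n] @ [\<nu> n + 2] = b # bs"
    by (cases "map \<nu> [1..<n] @ [\<nu> n + 2]") auto
  have "map \<nu> [0..<n] @ [\<nu> n + 2] = 1 # b # bs"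
    using bs n nu0 by (simp add: upt_conv_Cons)
  then have "of_int p / of_int (p' - p) = 1 + 1 / (of_int K / of_int P :: rat)"
    using x KP(2) bs by simp
  then have "of_int p * of_int K = (of_int (p' - p) * (of_int K + of_int P) :: rat)"
    using KP0 assms(1-3) by (simp add: field_simps)
  then have "p * K = (p' - p) * (K + P)" by (metis of_int_add of_int_eq_iff of_int_mult)
  then have e: "K * (2 * p - p') = (p' - p) * P" by (simp add: algebra_simps)
  have "coprime (p' - p) (2 * p - p')"
  proof (rule coprimeI)
    fix c assume "c dvd p' - p" "c dvd 2 * p - p'"
    moreover have "p = (p' - p) + (2 * p - p')" "p' = 2 * (p' - p) + (2 * p - p')" by simp_all
    ultimately have "c dvd p" "c dvd p'" by (metis dvd_add dvd_mult)+
    then show "is_unit c" using assms(4) coprime_common_divisor by blast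
  qed
  then have "\<bar>K\<bar> = \<bar>p' - p\<bar> \<and> \<bar>P\<bar> = \<bar>2 * p - p'\<bar>"
    using coprime_crossproduct_int[of K P "p' - p" "2 * p - p'"] KP(1) e
    by (simp add: abs_mult[symmetric] coprime_commute mult.commute)
  then show ?thesis using chain_params KP0 assms(1-3) by auto
qed

section \<open>One fermionic term in halved variables\<close>

lemma Imul_turn:
  assumes n: "1 \<le> n" and pos: "\<forall>i<n. 1 \<le> \<nu> i" and m: "m \<in> int_vecs (cf_dim n \<nu>)" and j: "j \<in> {1..cf_dim n \<nu>}"
  shows "Imul n \<nu> m j = (if turn n \<nu> j then m (j - 1) + m j - m (j + 1) else m (j - 1) + m (j + 1))"
proof -
  let ?d = "cf_dim n \<nu>"
  have z: "m (?d + 1) = 0" using m by (auto simp: int_vecs_def)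
  have le: "tpos \<nu> k \<le> ?d" if "k \<le> n" for k using tpos_mono[OF that, of \<nu>] by (simp add: cf_dim_tpos)
  have strict: "tpos \<nu> k < ?d" if "k < n" for k
    using tpos_mono[of "Suc k" n \<nu>] that pos by (force simp: cf_dim_tpos tpos_Suc)
  show ?thesis
  proof (cases "turn n \<nu> j")
    case True
    then have neg: "\<not> (j < ?d \<and> (\<forall>k\<in>{1..n}. j \<noteq> tpos \<nu> k))" by (auto simp: turn_def)
    show ?thesis
    proof (cases "\<exists>k\<in>{1..n - (if \<nu> n = 0 then 1 else 0)}. j = tpos \<nu> k")
      case False
      then have "j = tpos \<nu> n \<and> \<nu> n = 0"
        using True by (auto simp: turn_def split: if_splits) (metis One_nat_def atLeastAtMost_iff diff_Suc_1 le_Suc_eq not0_implies_Suc not_one_le_zero n)+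
      then have "j = ?d" "\<nu> n = 0" by (auto simp: cf_dim_tpos)
      then show ?thesis using Imul_eq[OF m, of j] neg False True j z by (simp add: kron_def)
    next
      case T: True
      have "1 \<le> j" using j by simp
      from Imul_eq[OF m this] show ?thesis unfolding if_not_P[OF neg] if_P[OF T] by (simp add: True)
    qed
  next
    case False
    then have F: "\<not> (\<exists>k\<in>{1..n - (if \<nu> n = 0 then 1 else 0)}. j = tpos \<nu> k)" "\<forall>k\<in>{1..n}. j \<noteq> tpos \<nu> k"
      by (auto simp: turn_def split: if_splits)
    show ?thesis
    proof (cases "j < ?d")
      case True
      then show ?thesis using Imul_eq[OF m, of j] F False j by simp
    next
      case ge: False
      then have jd: "j = ?d" using j by simp
      then have "\<nu> n \<noteq> 0" using F(2) n by (force simp: cf_dim_tpos)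
      then show ?thesis using Imul_eq[OF m, of j] F False j z ge jd by (simp add: kron_def)
    qed
  qed
qed

lemma mBm_eq:
  "mBm n \<nu> m = (\<Sum>j = 1..cf_dim n \<nu>. of_int (m j) * (of_int (m j) - of_int (Imul n \<nu> m j) / 2))"
  unfolding mBm_def
proof (rule sum.cong[OF refl])
  fix j assume j: "j \<in> {1..cf_dim n \<nu>}"
  let ?D = "{1..cf_dim n \<nu>}"
  have "(\<Sum>k\<in>?D. of_int (kron j k) * of_int (m k)) = (\<Sum>k\<in>?D. if j = k then of_int (m k) else (0::rat))"
    by (intro sum.cong) (auto simp: kron_def)
  then have s: "(\<Sum>k\<in>?D. of_int (kron j k) * of_int (m k)) = (of_int (m j) :: rat)"
    using j by simp
  have "(\<Sum>k\<in>?D. of_int (m j) * Bmat n \<nu> j k * of_int (m k))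
      = (\<Sum>k\<in>?D. of_int (m j) * (of_int (kron j k) * of_int (m k)) - of_int (m j) * (of_int (Imat n \<nu> j k * m k) / 2))"
    by (intro sum.cong refl) (simp add: Bmat_def field_simps)
  also have "\<dots> = of_int (m j) * (of_int (m j) - of_int (Imul n \<nu> m j) / 2)"
    unfolding sum_subtractf sum_distrib_left[symmetric] s
    by (simp add: Imul_def right_diff_distrib sum_divide_distrib)
  finally show "(\<Sum>k\<in>?D. of_int (m j) * Bmat n \<nu> j k * of_int (m k)) = of_int (m j) * (of_int (m j) - of_int (Imul n \<nu> m j) / 2)" .
qed

definition row_exp :: "bool \<Rightarrow> int \<Rightarrow> int \<Rightarrow> int" where
  "row_exp t y z = (if t then z\<^sup>2 else (y - z)\<^sup>2)"

text \<open>\<open>x\<close>, \<open>y\<close>, \<open>z\<close> are consecutive coordinates. The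
  summation index \<open>i\<close> of \<open>chain_fermion (t # ts) y (x - y)\<close> is
  \<open>z\<close> for a turn and \<open>y - z\<close> otherwise; \<open>row_exp\<close> is its
  square, and \<open>2 y + (x - y) - i\<close> is the upper entry.\<close>

definition row_factor :: "bool \<Rightarrow> int \<Rightarrow> int \<Rightarrow> int \<Rightarrow> rat fls" where
  "row_factor t x y z = qq (4 * row_exp t y z) * qbinom (if t then x + y - z else x + z) (2 * y)"

lemma qq_sum: "finite A \<Longrightarrow> qq (\<Sum>a\<in>A. f a) = (\<Prod>a\<in>A. qq (f a))"
  by (induction A rule: finite_induct) (simp_all add: qq_add)

text \<open>
  Substituting \<open>m_1 = 2 \<mu>_1 - L\<close> and \<open>m_j = 2 \<mu>_j\<close> otherwise absorbs all parity conditions and makes row 2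
  look like every later row.
\<close>

definition halve :: "int \<Rightarrow> (nat \<Rightarrow> int) \<Rightarrow> nat \<Rightarrow> int" where
  "halve L \<mu> j = 2 * \<mu> j - (if j = 1 then L else 0)"

lemma fermionic_term_halve:
  assumes n: "1 \<le> n" and pos: "\<forall>i<n. 1 \<le> \<nu> i" and nu0: "\<nu> 0 = 1"
    and mu: "\<mu> \<in> int_vecs (cf_dim n \<nu>)" and d: "1 \<le> cf_dim n \<nu>"
  shows "fermionic_term n \<nu> L (halve L \<mu>)
    = qq (2 * (\<mu> 1 - \<mu> 2)\<^sup>2 + 2 * (L - \<mu> 1 - \<mu> 2)\<^sup>2) * qbinom (\<mu> 1 - \<mu> 2) (L - \<mu> 1 - \<mu> 2)
      * (\<Prod>j = 2..cf_dim n \<nu>. row_factor (turn n \<nu> j) (\<mu> (j - 1)) (\<mu> j) (\<mu> (j + 1)))"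
proof -
  let ?d = "cf_dim n \<nu>" and ?m = "halve L \<mu>"
  have m: "?m \<in> int_vecs ?d" using mu d by (auto simp: int_vecs_def halve_def)
  have z: "\<mu> 0 = 0" "\<mu> (?d + 1) = 0" using mu by (auto simp: int_vecs_def)
  have mz: "?m 0 = 0" using m by (auto simp: int_vecs_def)
  have t1: "turn n \<nu> 1" using n nu0 by (force simp: turn_def tpos_def)
  let ?I = "\<lambda>j. if turn n \<nu> j then \<mu> (j - 1) + \<mu> j - \<mu> (j + 1) else \<mu> (j - 1) + \<mu> (j + 1)"
  have I: "Imul n \<nu> ?m j = 2 * ?I j - (if j = 2 then L else 0)" if "j \<in> {2..?d}" for j
    using Imul_turn[OF n pos m, of j] that by (auto simp: halve_def)
  have I1: "Imul n \<nu> ?m 1 = 2 * \<mu> 1 - L - 2 * \<mu> 2"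
    using Imul_turn[OF n pos m, of 1] t1 mz d by (simp add: halve_def numeral_2_eq_2)
  have D: "{1..?d} = insert 1 {2..?d}" using d by auto
  let ?top = "\<lambda>j. (L * (kron j 1 + kron j 2) + Imul n \<nu> ?m j) div 2"
  \<comment> \<open>With \<open>i = \<mu> 1 - \<mu> 2\<close> and \<open>l = \<mu> 2\<close> the
    complementary lower entry is \<open>L - i - 2 l\<close>, the form met in
    \<open>T0_burge\<close>.\<close>
  have top1: "qbinom (?top 1) (?m 1) = qbinom (\<mu> 1 - \<mu> 2) (L - \<mu> 1 - \<mu> 2)"
  proof -
    have "?top 1 = \<mu> 1 - \<mu> 2" using I1 by (simp add: kron_def)
    moreover have "?m 1 = (\<mu> 1 - \<mu> 2) - (L - \<mu> 1 - \<mu> 2)" by (simp add: halve_def)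
    ultimately show ?thesis using qbinom_sym by metis
  qed
  have topj: "qbinom (?top j) (?m j) = qbinom (?I j) (2 * \<mu> j)" if "j \<in> {2..?d}" for j
  proof -
    have "?top j = ?I j" using I[OF that] that by (auto simp: kron_def)
    moreover have "?m j = 2 * \<mu> j" using that by (auto simp: halve_def)
    ultimately show ?thesis by simp
  qed
  have prod: "(\<Prod>j = 1..?d. qbinom (?top j) (?m j)) = qbinom (\<mu> 1 - \<mu> 2) (L - \<mu> 1 - \<mu> 2) * (\<Prod>j = 2..?d. qbinom (?I j) (2 * \<mu> j))"
    unfolding D using top1 topj by simp
  \<comment> \<open>Row \<open>j \<ge> 2\<close> of \<open>mBm / 2\<close> is \<open>row_exp\<close>
    minus \<open>c j - c (j + 1)\<close>, apart from a term with \<open>L\<close> at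
    \<open>j = 2\<close>. The sum telescopes, \<open>c (d + 1)\<close> is 0, and \<open>c 2\<close>
    is absorbed into the exponent of row 1.\<close>
  let ?c = "\<lambda>j. \<mu> j * \<mu> (j - 1) - (\<mu> j)\<^sup>2"
  let ?w = "\<lambda>j. row_exp (turn n \<nu> j) (\<mu> j) (\<mu> (j + 1))"
  have tele: "(\<Sum>j = 2..?d. ?c j - ?c (j + 1)) = ?c 2 - ?c (?d + 1)"
  proof -
    have "(\<Sum>j = 2..?d. f j - f (j + 1)) = f 2 - f (?d + 1)" for f :: "nat \<Rightarrow> int"
      using sum_Suc_diff[of 2 ?d "\<lambda>j. - f j"] d by simp
    then show ?thesis .
  qed
  have "(\<Sum>j = 2..?d. of_int (?m j) * (of_int (?m j) - of_int (Imul n \<nu> ?m j) / 2) / 2)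
      = (\<Sum>j = 2..?d. of_int (?w j - (?c j - ?c (j + 1))) + (if j = 2 then of_int (\<mu> 2 * L) / 2 else (0::rat)))"
  proof (rule sum.cong[OF refl])
    fix j assume j: "j \<in> {2..?d}"
    have "?m j = 2 * \<mu> j" using j by (auto simp: halve_def)
    then show "of_int (?m j) * (of_int (?m j) - of_int (Imul n \<nu> ?m j) / 2) / 2
      = of_int (?w j - (?c j - ?c (j + 1))) + (if j = 2 then of_int (\<mu> 2 * L) / 2 else (0::rat))"
      unfolding I[OF j] row_exp_def by (auto simp: field_simps power2_eq_square numeral_3_eq_3)
  qed
  also have "\<dots> = of_int (\<Sum>j = 2..?d. ?w j) - of_int (?c 2) + of_int (\<mu> 2 * L) / 2"
  proof -
    have 1: "(\<Sum>j = 2..?d. if j = 2 then of_int (\<mu> 2 * L) / 2 else (0::rat)) = of_int (\<mu> 2 * L) / 2"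
      using mu by (auto simp: int_vecs_def)
    have "(\<Sum>j = 2..?d. ?w j - (?c j - ?c (j + 1))) = (\<Sum>j = 2..?d. ?w j) - ?c 2"
      unfolding sum_subtractf[of ?w] tele using z by simp
    then have 2: "(\<Sum>j = 2..?d. of_int (?w j - (?c j - ?c (j + 1)))) = (of_int (\<Sum>j = 2..?d. ?w j) - of_int (?c 2) :: rat)"
      by (simp only: of_int_diff[symmetric] of_int_sum[symmetric])
    show ?thesis unfolding sum.distrib 1 2 ..
  qed
  finally have "mBm n \<nu> ?m / 2 = of_int (?m 1) * (of_int (?m 1) - of_int (Imul n \<nu> ?m 1) / 2) / 2
       + (of_int (\<Sum>j = 2..?d. ?w j) - of_int (?c 2) + of_int (\<mu> 2 * L) / 2)"
    unfolding mBm_eq D by (simp add: sum_divide_distrib add_divide_distrib)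
  then have ex: "of_int (L * (L - 2 * ?m 2)) / 4 + mBm n \<nu> ?m / 2
      = of_int (2 * (\<mu> 1 - \<mu> 2)\<^sup>2 + 2 * (L - \<mu> 1 - \<mu> 2)\<^sup>2 + (\<Sum>j = 2..?d. 4 * ?w j)) / 4"
    unfolding I1 by (simp add: halve_def field_simps power2_eq_square sum_distrib_left[symmetric])
  have "qpow (of_int (L * (L - 2 * ?m 2)) / 4 + mBm n \<nu> ?m / 2)
      = qq (2 * (\<mu> 1 - \<mu> 2)\<^sup>2 + 2 * (L - \<mu> 1 - \<mu> 2)\<^sup>2) * (\<Prod>j = 2..?d. qq (4 * ?w j))"
    unfolding qpow_quarter[OF ex] by (simp add: qq_add qq_sum)
  then show ?thesis
    unfolding fermionic_term_def prod row_factor_def prod.distrib by (simp add: mult_ac)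
qed

section \<open>From sums over lattice vectors to iterated sums\<close>

definition box :: "nat set \<Rightarrow> int \<Rightarrow> (nat \<Rightarrow> int) set" where
  "box A R = {f. (\<forall>j\<in>A. f j \<in> {-R..R}) \<and> (\<forall>j. j \<notin> A \<longrightarrow> f j = 0)}"

lemma finite_box: "finite A \<Longrightarrow> finite (box A R)"
  using finite_set_of_finite_funs[of A "{-R..R}" 0] unfolding box_def
  by (rule rev_finite_subset) auto

lemma box_empty: "box {} R = {\<lambda>_. 0}"
  by (auto simp: box_def)

lemma sum_box_insert:
  assumes "k \<notin> A"
  shows "(\<Sum>g\<in>box (insert k A) R. F g) = (\<Sum>z\<in>{-R..R}. \<Sum>g\<in>box A R. F (g(k := z)))"
proof -
  have "(\<Sum>g\<in>box (insert k A) R. F g) = (\<Sum>(z, g)\<in>{-R..R} \<times> box A R. F (g(k := z)))"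
    by (rule sum.reindex_bij_witness[of _ "\<lambda>(z, g). g(k := z)" "\<lambda>g. (g k, g(k := 0))"])
       (use assms in \<open>auto simp: box_def fun_eq_iff\<close>)
  then show ?thesis by (simp add: sum.cartesian_product)
qed

lemma chain_fermion_nz: "chain_fermion ts L M \<noteq> 0 \<Longrightarrow> 0 \<le> L \<and> 0 \<le> M"
proof (cases ts)
  case (Cons t us)
  assume "chain_fermion ts L M \<noteq> 0"
  then obtain i where i: "i \<in> {0..L}" and "qbinom (2 * L + M - i) (2 * L) \<noteq> 0"
    unfolding Cons chain_fermion.simps by (metis (no_types, lifting) mult_zero_left mult_zero_right sum.neutral)
  then show ?thesis using qbinom_nz[of "2 * L + M - i" "2 * L"] by auto
qed (auto split: if_splits)

text \<open>With arguments written as \<open>y\<close> and \<open>x - y\<close>, both kinds of rows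
  recurse to \<open>z\<close> and \<open>y - z\<close>; the kind of the row survives in
  \<open>row_factor\<close> only.\<close>

lemma chain_fermion_Cons:
  assumes "y \<le> R"
  shows "chain_fermion (t # ts) y (x - y) = (\<Sum>z\<in>{-R..R}. row_factor t x y z * chain_fermion ts z (y - z))"
proof -
  have "chain_fermion (t # ts) y (x - y) = (\<Sum>z\<in>{0..y}. row_factor t x y z * chain_fermion ts z (y - z))"
  proof (cases t)
    case True
    then show ?thesis by (auto simp: row_factor_def row_exp_def algebra_simps intro!: sum.cong)
  next
    case False
    have "chain_fermion (t # ts) y (x - y) = (\<Sum>i\<in>{0..y}. row_factor t x y (y - i) * chain_fermion ts (y - i) (y - (y - i)))"
      using False by (auto simp: row_factor_def row_exp_def algebra_simps intro!: sum.cong)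
    also have "\<dots> = (\<Sum>z\<in>{0..y}. row_factor t x y z * chain_fermion ts z (y - z))"
      by (rule sum.reindex_bij_witness[of _ "\<lambda>z. y - z" "\<lambda>i. y - i"]) auto
    finally show ?thesis .
  qed
  also have "\<dots> = (\<Sum>z\<in>{-R..R}. row_factor t x y z * chain_fermion ts z (y - z))"
    using chain_fermion_nz[of ts _] assms by (intro sum.mono_neutral_left) force+
  finally show ?thesis .
qed

text \<open>\<open>f\<close> holds the coordinates up to \<open>k\<close>, already chosen, and
  \<open>g\<close> the later ones. Coordinate \<open>k + length ts\<close> lies outside the box and
  so reads as 0; it stands for \<open>\<mu> (d + 1)\<close>.\<close>

lemma chain_fermion_eq_sum_box:
  assumes "ts \<noteq> []" "0 \<le> R" "1 \<le> k" "f k \<le> R"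
  shows "chain_fermion ts (f k) (f (k - 1) - f k)
    = (\<Sum>g\<in>box {Suc k..<k + length ts} R. \<Prod>j\<in>{k..<k + length ts}.
         row_factor (ts ! (j - k)) (if j - 1 \<le> k then f (j - 1) else g (j - 1))
           (if j \<le> k then f j else g j) (if j + 1 \<le> k then f (j + 1) else g (j + 1)))"
  using assms
proof (induction ts arbitrary: k f)
  case (Cons t ts)
  show ?case
  proof (cases "ts = []")
    case True
    have "chain_fermion [t] (f k) (f (k - 1) - f k) = (\<Sum>z\<in>{-R..R}. row_factor t (f (k - 1)) (f k) z * chain_fermion [] z (f k - z))"
      using Cons.prems by (intro chain_fermion_Cons) auto
    also have "\<dots> = (\<Sum>z\<in>{-R..R}. if z = 0 then row_factor t (f (k - 1)) (f k) 0 else 0)"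
    proof (intro sum.cong refl)
      fix z
      \<comment> \<open>The empty chain demands \<open>z = 0\<close> and \<open>0 \<le> f k\<close>;
        the lower entry \<open>2 * f k\<close> already enforces the second.\<close>
      have "row_factor t (f (k - 1)) (f k) 0 = 0" if "f k < 0"
        using that by (simp add: row_factor_def qbinom_def)
      then show "row_factor t (f (k - 1)) (f k) z * chain_fermion [] z (f k - z) = (if z = 0 then row_factor t (f (k - 1)) (f k) 0 else 0)"
        by auto
    qed
    also have "\<dots> = row_factor t (f (k - 1)) (f k) 0" using Cons.prems by simp
    finally show ?thesis using True by (simp add: box_empty)
  next
    case False
    let ?P = "\<lambda>ts k f g. \<Prod>j\<in>{k..<k + length ts}.
         row_factor (ts ! (j - k)) (if j - 1 \<le> k then f (j - 1) else g (j - 1))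
           (if j \<le> k then f j else g j) (if j + 1 \<le> k then f (j + 1) else g (j + 1))"
    let ?n = "k + length (t # ts)"
    have step: "?P (t # ts) k f (g(Suc k := z)) = row_factor t (f (k - 1)) (f k) z * ?P ts (Suc k) (f(Suc k := z)) g" for g z
    proof -
      have I: "{k..<?n} = insert k {Suc k..<Suc k + length ts}" by auto
      have "?P (t # ts) k f (g(Suc k := z)) = row_factor t (f (k - 1)) (f k) z *
        (\<Prod>j\<in>{Suc k..<Suc k + length ts}.
         row_factor ((t # ts) ! (j - k)) (if j - 1 \<le> k then f (j - 1) else (g(Suc k := z)) (j - 1))
           (if j \<le> k then f j else (g(Suc k := z)) j) (if j + 1 \<le> k then f (j + 1) else (g(Suc k := z)) (j + 1)))"
        unfolding I by simp
      also have "(\<Prod>j\<in>{Suc k..<Suc k + length ts}.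
         row_factor ((t # ts) ! (j - k)) (if j - 1 \<le> k then f (j - 1) else (g(Suc k := z)) (j - 1))
           (if j \<le> k then f j else (g(Suc k := z)) j) (if j + 1 \<le> k then f (j + 1) else (g(Suc k := z)) (j + 1)))
         = ?P ts (Suc k) (f(Suc k := z)) g"
      proof (rule prod.cong[OF refl])
        fix j assume j: "j \<in> {Suc k..<Suc k + length ts}"
        then have 1: "(t # ts) ! (j - k) = ts ! (j - Suc k)" by (simp add: nth_Cons')
        have 2: "(if i \<le> k then f i else (g(Suc k := z)) i) = (if i \<le> Suc k then (f(Suc k := z)) i else g i)" for i
          by (auto simp: le_Suc_eq)
        show "row_factor ((t # ts) ! (j - k)) (if j - 1 \<le> k then f (j - 1) else (g(Suc k := z)) (j - 1))
           (if j \<le> k then f j else (g(Suc k := z)) j) (if j + 1 \<le> k then f (j + 1) else (g(Suc k := z)) (j + 1))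
          = row_factor (ts ! (j - Suc k)) (if j - 1 \<le> Suc k then (f(Suc k := z)) (j - 1) else g (j - 1))
           (if j \<le> Suc k then (f(Suc k := z)) j else g j) (if j + 1 \<le> Suc k then (f(Suc k := z)) (j + 1) else g (j + 1))"
          by (simp only: 1 2)
      qed
      finally show ?thesis .
    qed
    have "chain_fermion (t # ts) (f k) (f (k - 1) - f k) = (\<Sum>z\<in>{-R..R}. row_factor t (f (k - 1)) (f k) z * chain_fermion ts z (f k - z))"
      using Cons.prems by (intro chain_fermion_Cons) auto
    also have "\<dots> = (\<Sum>z\<in>{-R..R}. row_factor t (f (k - 1)) (f k) z * (\<Sum>g\<in>box {Suc (Suc k)..<Suc k + length ts} R. ?P ts (Suc k) (f(Suc k := z)) g))"
    proof (rule sum.cong[OF refl])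
      fix z assume "z \<in> {-R..R}"
      then show "row_factor t (f (k - 1)) (f k) z * chain_fermion ts z (f k - z)
         = row_factor t (f (k - 1)) (f k) z * (\<Sum>g\<in>box {Suc (Suc k)..<Suc k + length ts} R. ?P ts (Suc k) (f(Suc k := z)) g)"
        using Cons.IH[OF False, of "Suc k" "f(Suc k := z)"] Cons.prems by simp
    qed
    also have "\<dots> = (\<Sum>z\<in>{-R..R}. \<Sum>g\<in>box {Suc (Suc k)..<Suc k + length ts} R. ?P (t # ts) k f (g(Suc k := z)))"
      by (simp only: step sum_distrib_left)
    also have "\<dots> = (\<Sum>g\<in>box (insert (Suc k) {Suc (Suc k)..<Suc k + length ts}) R. ?P (t # ts) k f g)"
      by (rule sum_box_insert[symmetric]) simp
    also have "insert (Suc k) {Suc (Suc k)..<Suc k + length ts} = {Suc k..<?n}"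
      using False by (cases ts) auto
    finally show ?thesis .
  qed
qed simp

lemma Sum_any_fermionic_box:
  assumes n: "1 \<le> n" and nu0: "\<nu> 0 = 1" and d: "1 \<le> cf_dim n \<nu>"
  obtains R where "\<bar>L\<bar> \<le> R"
    "Sum_any (\<lambda>m. if m \<in> summation_vecs (cf_dim n \<nu>) L then fermionic_term n \<nu> L m else 0)
     = (\<Sum>\<mu>\<in>box {1..cf_dim n \<nu>} R. fermionic_term n \<nu> L (halve L \<mu>))"
proof -
  let ?d = "cf_dim n \<nu>"
  let ?g = "\<lambda>m. if m \<in> summation_vecs ?d L then fermionic_term n \<nu> L m else 0"
  \<comment> \<open>The inserted 0 keeps \<open>Max X\<close> meaningful when no term
    contributes.\<close>
  define X where "X = insert 0 (\<Union>m\<in>{m. ?g m \<noteq> 0}. (\<lambda>j. \<bar>m j\<bar>) ` {1..?d})"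
  have finX: "finite X" using finite_fermionic[of n \<nu> L, OF n nu0] by (simp add: X_def)
  define R where "R = Max X + \<bar>L\<bar>"
  have X: "x \<le> Max X" if "x \<in> X" for x using finX that by simp
  have "0 \<le> Max X" using X by (simp add: X_def)
  have sub: "{m. ?g m \<noteq> 0} \<subseteq> halve L ` box {1..?d} R"
  proof
    fix m assume m: "m \<in> {m. ?g m \<noteq> 0}"
    then have ms: "m \<in> summation_vecs ?d L" by (auto split: if_splits)
    define \<mu> where "\<mu> j = (m j + (if j = 1 then L else 0)) div 2" for j
    have ev: "even (m j + (if j = 1 then L else 0))" if "j \<in> {1..?d}" for j
      using ms that by (auto simp: summation_vecs_def kron_def split: if_splits)
    have z: "m j = 0" if "j \<notin> {1..?d}" for j using ms that by (auto simp: summation_vecs_def int_vecs_def)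
    have "m = halve L \<mu>"
    proof
      fix j show "m j = halve L \<mu> j"
      proof (cases "j \<in> {1..?d}")
        case True
        then show ?thesis using ev[OF True] by (simp add: halve_def \<mu>_def)
      next
        case False
        then have "j \<noteq> 1" using d by auto
        then show ?thesis using z[OF False] by (simp add: halve_def \<mu>_def)
      qed
    qed
    moreover have "\<mu> \<in> box {1..?d} R"
    proof -
      have "\<mu> j \<in> {-R..R}" if j: "j \<in> {1..?d}" for j
      proof -
        have "\<bar>m j\<bar> \<in> X" unfolding X_def using m j by blast
        then have "\<bar>m j\<bar> \<le> Max X" by (rule X)
        moreover have "2 * \<mu> j = m j + (if j = 1 then L else 0)" using ev[OF j] by (simp add: \<mu>_def)
        ultimately show ?thesis unfolding R_def by (auto split: if_splits)
      qed
      moreover have "\<mu> j = 0" if j: "j \<notin> {1..?d}" for j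
        using z[OF j] j d by (auto simp: \<mu>_def)
      ultimately show ?thesis by (simp add: box_def)
    qed
    ultimately show "m \<in> halve L ` box {1..?d} R" by blast
  qed
  have inj: "inj_on (halve L) (box {1..?d} R)"
  proof (rule inj_onI)
    fix f g assume "halve L f = halve L g"
    then have "halve L f j = halve L g j" for j by simp
    then have "f j = g j" for j by (simp add: halve_def)
    then show "f = g" by auto
  qed
  have mem: "halve L \<mu> \<in> summation_vecs ?d L" if "\<mu> \<in> box {1..?d} R" for \<mu>
    using that d by (auto simp: summation_vecs_def int_vecs_def box_def halve_def kron_def)
  have "Sum_any ?g = sum ?g (halve L ` box {1..?d} R)"
    using sub by (intro Sum_any.expand_superset finite_imageI finite_box) auto
  also have "\<dots> = (\<Sum>\<mu>\<in>box {1..?d} R. ?g (halve L \<mu>))"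
    using inj by (simp add: sum.reindex)
  also have "\<dots> = (\<Sum>\<mu>\<in>box {1..?d} R. fermionic_term n \<nu> L (halve L \<mu>))"
    using mem by (intro sum.cong refl) auto
  finally show ?thesis using that[of R] \<open>0 \<le> Max X\<close> by (simp add: R_def)
qed

text \<open>\<open>\<mu> 1 = i + l\<close> and \<open>\<mu> 2 = l\<close> yield the two outer sums;
  the coordinates from 3 on are those summed inside the chain.\<close>

lemma fermionic_sum_eq:
  assumes n: "1 \<le> n" and pos: "\<forall>i<n. 1 \<le> \<nu> i" and nu0: "\<nu> 0 = 1"
  shows "Sum_any (\<lambda>m. if m \<in> summation_vecs (cf_dim n \<nu>) L then fermionic_term n \<nu> L m else 0)
    = (\<Sum>l\<in>{0..L}. \<Sum>i\<in>{0..L}. qq (2 * i\<^sup>2 + 2 * (L - i - 2 * l)\<^sup>2) * qbinom i (L - i - 2 * l)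
      * chain_fermion (map (turn n \<nu>) [2..<Suc (cf_dim n \<nu>)]) l i)"
proof -
  let ?d = "cf_dim n \<nu>" and ?ts = "map (turn n \<nu>) [2..<Suc (cf_dim n \<nu>)]"
  have d: "1 \<le> ?d"
    using n nu0 member_le_sum[of 0 "{..n}" \<nu>] by (simp add: cf_dim_def)
  let ?w = "\<lambda>x y. qq (2 * (x - y)\<^sup>2 + 2 * (L - x - y)\<^sup>2) * qbinom (x - y) (L - x - y)"
  obtain R where R: "\<bar>L\<bar> \<le> R"
    and S: "Sum_any (\<lambda>m. if m \<in> summation_vecs ?d L then fermionic_term n \<nu> L m else 0)
     = (\<Sum>\<mu>\<in>box {1..?d} R. fermionic_term n \<nu> L (halve L \<mu>))"
    using Sum_any_fermionic_box[OF n nu0 d] by blast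
  let ?T = "\<lambda>\<mu>. ?w (\<mu> 1) (\<mu> 2) * (\<Prod>j = 2..?d. row_factor (turn n \<nu> j) (\<mu> (j - 1)) (\<mu> j) (\<mu> (j + 1)))"
  have "(\<Sum>\<mu>\<in>box {1..?d} R. fermionic_term n \<nu> L (halve L \<mu>)) = (\<Sum>\<mu>\<in>box {1..?d} R. ?T \<mu>)"
    by (intro sum.cong refl fermionic_term_halve[OF n pos nu0 _ d]) (auto simp: box_def int_vecs_def)
  also have "\<dots> = (\<Sum>x\<in>{-R..R}. \<Sum>y\<in>{-R..R}. ?w x y * chain_fermion ?ts y (x - y))"
  proof (cases "?d = 1")
    \<comment> \<open>For \<open>d = 1\<close> there is no second coordinate: the empty chain forces
      \<open>y = 0\<close>, the value of \<open>\<mu> 2\<close> outside the index range.\<close>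
    case True
    have "(\<Sum>\<mu>\<in>box {1..?d} R. ?T \<mu>) = (\<Sum>x\<in>{-R..R}. ?w x 0)"
      unfolding True using sum_box_insert[of 1 "{}" ?T R] by (simp add: box_empty True)
    also have "\<dots> = (\<Sum>x\<in>{-R..R}. \<Sum>y\<in>{-R..R}. if y = 0 then ?w x 0 else 0)"
      using R by simp
    also have "\<dots> = (\<Sum>x\<in>{-R..R}. \<Sum>y\<in>{-R..R}. ?w x y * chain_fermion ?ts y (x - y))"
      by (intro sum.cong refl) (use True in \<open>auto simp: qbinom_def\<close>)
    finally show ?thesis .
  next
    case False
    then have d2: "2 \<le> ?d" using d by simp
    have I: "{1..?d} = insert 1 (insert 2 {3..?d})" using d2 by auto
    have J: "{Suc 2..<2 + length ?ts} = {3..?d}" "{2..<2 + length ?ts} = {2..?d}" using d2 by auto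
    have "(\<Sum>\<mu>\<in>box {1..?d} R. ?T \<mu>) = (\<Sum>x\<in>{-R..R}. \<Sum>y\<in>{-R..R}. \<Sum>g\<in>box {3..?d} R. ?T (g(2 := y, 1 := x)))"
      unfolding I by (subst sum_box_insert, simp, subst sum_box_insert, simp, rule refl)
    also have "\<dots> = (\<Sum>x\<in>{-R..R}. \<Sum>y\<in>{-R..R}. ?w x y * chain_fermion ?ts y (x - y))"
    proof (intro sum.cong refl)
      fix x y assume y: "y \<in> {-R..R}"
      define f :: "nat \<Rightarrow> int" where "f = (\<lambda>_. 0)(2 := y, 1 := x)"
      have "chain_fermion ?ts (f 2) (f (2 - 1) - f 2) = (\<Sum>g\<in>box {Suc 2..<2 + length ?ts} R. \<Prod>j\<in>{2..<2 + length ?ts}.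
         row_factor (?ts ! (j - 2)) (if j - 1 \<le> 2 then f (j - 1) else g (j - 1))
           (if j \<le> 2 then f j else g j) (if j + 1 \<le> 2 then f (j + 1) else g (j + 1)))"
        using y R d2 by (intro chain_fermion_eq_sum_box) (auto simp: f_def)
      also have "\<dots> = (\<Sum>g\<in>box {3..?d} R. \<Prod>j = 2..?d. row_factor (turn n \<nu> j) ((g(2 := y, 1 := x)) (j - 1)) ((g(2 := y, 1 := x)) j) ((g(2 := y, 1 := x)) (j + 1)))"
        unfolding J
      proof (intro sum.cong prod.cong refl)
        fix g j assume j: "j \<in> {2..?d}"
        have "j - 2 < Suc ?d - 2" "2 + (j - 2) = j" using j by auto
        then have 1: "?ts ! (j - 2) = turn n \<nu> j" by (simp del: upt_Suc add_2_eq_Suc)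
        have h: "(if i \<le> 2 then f i else g i) = (g(2 := y, 1 := x)) i" if "1 \<le> i" for i
          using that by (auto simp: f_def)
        have le: "1 \<le> j - 1" "1 \<le> j" "1 \<le> j + 1" using j by auto
        show "row_factor (?ts ! (j - 2)) (if j - 1 \<le> 2 then f (j - 1) else g (j - 1))
           (if j \<le> 2 then f j else g j) (if j + 1 \<le> 2 then f (j + 1) else g (j + 1))
          = row_factor (turn n \<nu> j) ((g(2 := y, 1 := x)) (j - 1)) ((g(2 := y, 1 := x)) j) ((g(2 := y, 1 := x)) (j + 1))"
          unfolding 1 h[OF le(1)] h[OF le(2)] h[OF le(3)] ..
      qed
      finally have F: "chain_fermion ?ts y (x - y) = \<dots>" by (simp add: f_def)
      show "(\<Sum>g\<in>box {3..?d} R. ?T (g(2 := y, 1 := x))) = ?w x y * chain_fermion ?ts y (x - y)"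
        unfolding F sum_distrib_left by (intro sum.cong refl) simp
    qed
    finally show ?thesis .
  qed
  also have "\<dots> = sum (\<lambda>(x, y). ?w x y * chain_fermion ?ts y (x - y)) ({-R..R} \<times> {-R..R})"
    by (simp add: sum.cartesian_product)
  also have "\<dots> = sum (\<lambda>(x, y). ?w x y * chain_fermion ?ts y (x - y)) {(x, y). 0 \<le> y \<and> 0 \<le> x - y \<and> x + y \<le> L}"
  proof (rule sum.mono_neutral_right)
    show "\<forall>v\<in>{-R..R} \<times> {-R..R} - {(x, y). 0 \<le> y \<and> 0 \<le> x - y \<and> x + y \<le> L}. (case v of (x, y) \<Rightarrow> ?w x y * chain_fermion ?ts y (x - y)) = 0"
    proof
      fix v assume v: "v \<in> {-R..R} \<times> {-R..R} - {(x, y). 0 \<le> y \<and> 0 \<le> x - y \<and> x + y \<le> L}"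
      obtain x y where xy: "v = (x, y)" by (cases v)
      have "qbinom (x - y) (L - x - y) = 0 \<or> chain_fermion ?ts y (x - y) = 0"
      proof (rule ccontr)
        assume *: "\<not> (qbinom (x - y) (L - x - y) = 0 \<or> chain_fermion ?ts y (x - y) = 0)"
        then have "0 \<le> y \<and> 0 \<le> x - y" using chain_fermion_nz by blast
        moreover have "0 \<le> L - x - y" using * qbinom_nz by blast
        ultimately show False using v unfolding xy by simp
      qed
      then show "(case v of (x, y) \<Rightarrow> ?w x y * chain_fermion ?ts y (x - y)) = 0" unfolding xy by auto
    qed
  qed (use R in auto)
  also have "\<dots> = sum (\<lambda>(l, i). qq (2 * i\<^sup>2 + 2 * (L - i - 2 * l)\<^sup>2) * qbinom i (L - i - 2 * l) * chain_fermion ?ts l i)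
      {(l, i). 0 \<le> l \<and> 0 \<le> i \<and> i + 2 * l \<le> L}"
  proof (rule sum.reindex_bij_witness[of _ "\<lambda>(l, i). (i + l, l)" "\<lambda>(x, y). (y, x - y)"])
    fix v assume "v \<in> {(x, y). 0 \<le> y \<and> 0 \<le> x - y \<and> x + y \<le> L}"
    obtain x y where xy: "v = (x, y)" by (cases v)
    have "L - (x - y) - 2 * y = L - x - y" by simp
    then show "(case (case v of (x, y) \<Rightarrow> (y, x - y)) of (l, i) \<Rightarrow> qq (2 * i\<^sup>2 + 2 * (L - i - 2 * l)\<^sup>2) * qbinom i (L - i - 2 * l) * chain_fermion ?ts l i)
      = (case v of (x, y) \<Rightarrow> ?w x y * chain_fermion ?ts y (x - y))"
      unfolding xy prod.case by (simp only:)
  qed auto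
  also have "\<dots> = sum (\<lambda>(l, i). qq (2 * i\<^sup>2 + 2 * (L - i - 2 * l)\<^sup>2) * qbinom i (L - i - 2 * l) * chain_fermion ?ts l i) ({0..L} \<times> {0..L})"
  proof (rule sum.mono_neutral_left)
    show "\<forall>v\<in>{0..L} \<times> {0..L} - {(l, i). 0 \<le> l \<and> 0 \<le> i \<and> i + 2 * l \<le> L}.
      (case v of (l, i) \<Rightarrow> qq (2 * i\<^sup>2 + 2 * (L - i - 2 * l)\<^sup>2) * qbinom i (L - i - 2 * l) * chain_fermion ?ts l i) = 0"
      by (auto dest!: qbinom_nz simp del: upt_Suc)
  qed auto
  finally show ?thesis unfolding S by (simp add: sum.cartesian_product)
qed

theorem proposition4p2:
  fixes p p' r s L :: int and n :: nat and \<nu> :: "nat \<Rightarrow> nat"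
  assumes "1 < p" and "3 * p < 2 * p'" and "p' < 2 * p" and "coprime p p'"
    and "1 \<le> r" and "r < p" and "1 \<le> s" and "s < p'" and "\<bar>p' * r - p * s\<bar> = 1"
    and "cfrac_expansion (of_int p / of_int (p' - p)) n \<nu>"
  shows "Sum_any (\<lambda>m. if m \<in> summation_vecs (cf_dim n \<nu>) L then fermionic_term n \<nu> L m else 0)
       = Sum_any (\<lambda>j::int. bosonic_term p p' r s L j)"
proof -
  have "of_int p / of_int (p' - p) < (2 :: rat)"
  proof -
    have "(of_int p :: rat) < of_int (2 * (p' - p))" unfolding of_int_less_iff using assms(2) by (simp add: algebra_simps)
    moreover have "(0 :: rat) < of_int (p' - p)" unfolding of_int_0_less_iff using assms(1,2) by linarith
    ultimately show ?thesis by (simp add: divide_less_eq)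
  qed
  with assms(10) have n: "1 \<le> n" and nu0: "\<nu> 0 = 1"
    using cfrac_expansion_start by blast+
  have pos: "\<forall>i<n. 1 \<le> \<nu> i" using assms(10) by (simp add: cfrac_expansion_def)
  have KP: "1 \<le> p' - p" "1 \<le> 2 * p - p'" using assms(1-3) by linarith+
  have det: "\<bar>(p' - p) * (2 * r - s) - (2 * p - p') * (s - r)\<bar> = 1"
    using assms(9) by (simp add: algebra_simps)
  \<comment> \<open>Here \<open>u + v = r\<close> lies strictly between 0 and
    \<open>K + P = p\<close>.\<close>
  have "0 \<le> s - r \<and> s - r \<le> p' - p"
    using KP det assms(5,6) by (intro admissible_bounds[of _ "2 * p - p'" "2 * r - s"]) auto
  moreover have "0 \<le> 2 * r - s \<and> 2 * r - s \<le> 2 * p - p'"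
    using KP det assms(5,6) by (intro admissible_bounds[of _ "p' - p" "s - r"]) (auto simp: abs_minus_commute)
  ultimately have admissible: "admissible (p' - p) (2 * p - p') (s - r) (2 * r - s)"
    using KP det by (simp add: admissible_def)
  show ?thesis
    unfolding fermionic_sum_eq[OF n pos nu0] sum_T0_boson[OF admissible, symmetric]
    by (simp only: chain_fermion_eq_boson[OF chain_params_cfrac[OF assms(1-4,10) n nu0] admissible])
qed

end
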